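(* Let $q$ be a nonzero complex number and let $d\geq 1$. Let $g_1(\mathbf{x}),\dots,g_n(\mathbf{x})$ be power series in $\mathfrak{L}_d$ which are algebraically independent over $\mathbb{C}(\mathbf{x})$. Then for any $f_i(q;\mathbf{x})\in\mathcal{D}(q;g_i)$, $1\leq i\leq n$, the series $f_1(q;\mathbf{x}),\dots,f_n(q;\mathbf{x})$ are also algebraically independent over $\mathbb{C}(\mathbf{x})$.
   Context: $\mathbf{x}=(x_1,\dots,x_d)$ is a vector of indeterminates, and for a positive integer $m$, $\mathbf{x}^{m}=(x_1^{m},\dots,x_d^{m})$. $\phi_b$ denotes the $b$th cyclotomic polynomial over $\mathbb{Q}$. $\mathfrak{L}_d$ is the set of all power series $g(\mathbf{x})\in\mathbb{Z}[[\mathbf{x}]]$ with constant term $1$ such that for every prime number $p$ there exist a positive integer $k$ and a polynomial $A\in\mathbb{Z}[\mathbf{x}]$ with $\deg_{x_i}(A)\leq p^k-1$ for all $1\leq i\leq d$ and $g(\mathbf{x})\equiv A(\mathbf{x})g(\mathbf{x}^{p^k}) \bmod p\mathbb{Z}[[\mathbf{x}]]$. For a fixed nonzero complex number $q$ and $g\in\mathfrak{L}_d$, $\mathcal{D}(q;g)$ is the set of all nonzero power series $f(q;\mathbf{x})\in\mathbb{Z}[q][[\mathbf{x}]]$ (here $\mathbb{Z}[q]\subset\mathbb{C}$ is the ring generated by $q$) such that for every integer $b\geq 1$ there is a polynomial $A(q;\mathbf{x})$ with coefficients in $\mathbb{Z}[q]$ satisfying $f(q;\mathbf{x})\equiv A(q;\mathbf{x})g(\mathbf{x}^b)\bmod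 \phi_b(q)\mathbb{Z}[q][[\mathbf{x}]]$. Power series are algebraically independent over $\mathbb{C}(\mathbf{x})$ if no nonzero polynomial with coefficients in $\mathbb{C}(\mathbf{x})$ vanishes at them. *)

theory Defs
  imports Complex_Main "HOL-Library.Poly_Mapping"
    "HOL-Computational_Algebra.Polynomial_Factorial"
begin

section \<open>Multivariate polynomials and power series\<close>

text \<open>
  A monomial in the indeterminates \<open>x\<^sub>i\<close> (\<open>i :: 'v\<close>) is identified with its exponent vector
  \<open>'v \<Rightarrow>\<^sub>0 nat\<close>. Polynomials are finitely supported functions on monomials; their ring
  structure (convolution product) is the one of \<^theory>\<open>HOL-Library.Poly_Mapping\<close>. Power series
  are arbitrary functions on monomials. For \<open>d\<close> indeterminates, \<open>'v\<close> is a finite type with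
  \<open>d\<close> elements.
\<close>

type_synonym ('v, 'a) mpoly = "('v \<Rightarrow>\<^sub>0 nat) \<Rightarrow>\<^sub>0 'a"

typedef ('v, 'a) mfps = "UNIV :: (('v \<Rightarrow>\<^sub>0 nat) \<Rightarrow> 'a) set"
  morphisms mfps_nth Abs_mfps
  by simp

lemma mfps_nth_Abs [simp]: "mfps_nth (Abs_mfps f) = f"
  by (simp add: Abs_mfps_inverse)

lemma mfps_eqI: "(\<And>m. mfps_nth f m = mfps_nth g m) \<Longrightarrow> f = g"
  by (metis ext mfps_nth_inject)

lemma mfps_eq_iff: "f = g \<longleftrightarrow> (\<forall>m. mfps_nth f m = mfps_nth g m)"
  using mfps_eqI by blast

lemma finite_monomial_splits:
  fixes m :: "'v \<Rightarrow>\<^sub>0 nat"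
  shows "finite {(a, b). a + b = m}"
proof -
  have le: "Poly_Mapping.lookup a i \<le> Poly_Mapping.lookup m i" if "a + b = m" for a b i
    using that by (auto simp: lookup_add)
  let ?K = "Poly_Mapping.keys m"
  let ?S = "{f. \<forall>i. (i \<in> ?K \<longrightarrow> f i \<in> {..Max (Poly_Mapping.lookup m ` ?K)}) \<and> (i \<notin> ?K \<longrightarrow> f i = 0)}"
  have S: "finite ?S"
    by (rule finite_set_of_finite_funs) auto
  have inS: "Poly_Mapping.lookup a \<in> ?S" if "a + b = m" for a b
  proof -
    have "Poly_Mapping.lookup a i \<le> Max (Poly_Mapping.lookup m ` ?K)" if i: "i \<in> ?K" for i
      using le[OF \<open>a + b = m\<close>, of i] i by (meson Max_ge finite_imageI finite_keys image_eqI le_trans)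
    moreover have "Poly_Mapping.lookup a i = 0" if i: "i \<notin> ?K" for i
      using le[OF \<open>a + b = m\<close>, of i] i by (simp add: in_keys_iff)
    ultimately show ?thesis by auto
  qed
  have "finite {a. Poly_Mapping.lookup a \<in> ?S}"
    using finite_vimageI[OF S, of Poly_Mapping.lookup]
    by (simp add: vimage_def inj_def poly_mapping_eqI)
  then have fin: "finite ({a. Poly_Mapping.lookup a \<in> ?S} \<times> {a. Poly_Mapping.lookup a \<in> ?S})"
    by simp
  show ?thesis
  proof (rule finite_subset[OF _ fin], rule subsetI)
    fix p assume "p \<in> {(a, b). a + b = m}"
    then obtain a b where p: "p = (a, b)" and ab: "a + b = m"
      by auto
    from ab have ba: "b + a = m"
      by (simp add: add.commute)
    show "p \<in> {a. Poly_Mapping.lookup a \<in> ?S} \<times> {a. Poly_Mapping.lookup a \<in> ?S}"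
      using inS[OF ab] inS[OF ba] by (simp only: p mem_Times_iff fst_conv snd_conv mem_Collect_eq)
  qed
qed

instantiation mfps :: (type, comm_ring_1) comm_ring_1
begin

definition zero_mfps :: "('a, 'b) mfps" where
  "zero_mfps = Abs_mfps (\<lambda>_. 0)"

definition one_mfps :: "('a, 'b) mfps" where
  "one_mfps = Abs_mfps (\<lambda>m. if m = 0 then 1 else 0)"

definition plus_mfps :: "('a, 'b) mfps \<Rightarrow> ('a, 'b) mfps \<Rightarrow> ('a, 'b) mfps" where
  "plus_mfps f g = Abs_mfps (\<lambda>m. mfps_nth f m + mfps_nth g m)"

definition minus_mfps :: "('a, 'b) mfps \<Rightarrow> ('a, 'b) mfps \<Rightarrow> ('a, 'b) mfps" where
  "minus_mfps f g = Abs_mfps (\<lambda>m. mfps_nth f m - mfps_nth g m)"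

definition uminus_mfps :: "('a, 'b) mfps \<Rightarrow> ('a, 'b) mfps" where
  "uminus_mfps f = Abs_mfps (\<lambda>m. - mfps_nth f m)"

definition times_mfps :: "('a, 'b) mfps \<Rightarrow> ('a, 'b) mfps \<Rightarrow> ('a, 'b) mfps" where
  "times_mfps f g = Abs_mfps (\<lambda>m. \<Sum>(a, b)\<in>{(a, b). a + b = m}. mfps_nth f a * mfps_nth g b)"

instance
proof
  fix f g h :: "('a, 'b) mfps"
  show "f + g + h = f + (g + h)" "f + g = g + f" "0 + f = f" "- f + f = 0" "f - g = f + - g"
    by (simp_all add: plus_mfps_def zero_mfps_def minus_mfps_def uminus_mfps_def mfps_eq_iff
        algebra_simps)
  show "(0 :: ('a, 'b) mfps) \<noteq> 1"
    by (auto simp: zero_mfps_def one_mfps_def mfps_eq_iff)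
  show "f * g = g * f"
  proof (rule mfps_eqI)
    fix m
    show "mfps_nth (f * g) m = mfps_nth (g * f) m"
      unfolding times_mfps_def mfps_nth_Abs
      by (rule sum.reindex_bij_witness[where i = prod.swap and j = prod.swap])
         (auto simp: add.commute mult.commute)
  qed
  show "(f + g) * h = f * h + g * h"
    by (simp add: times_mfps_def plus_mfps_def mfps_eq_iff case_prod_unfold distrib_right
        sum.distrib)
  show "1 * f = f"
  proof (rule mfps_eqI)
    fix m
    have "mfps_nth (1 * f) m = (\<Sum>p\<in>{(a, b). a + b = m}. if p = (0, m) then mfps_nth f m else 0)"
      unfolding times_mfps_def one_mfps_def mfps_nth_Abs
      by (rule sum.cong) (auto split: if_splits)
    also have "\<dots> = mfps_nth f m"
      by (simp add: finite_monomial_splits)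
    finally show "mfps_nth (1 * f) m = mfps_nth f m" .
  qed
  show "f * g * h = f * (g * h)"
  proof (rule mfps_eqI)
    fix m :: "'a \<Rightarrow>\<^sub>0 nat"
    let ?t = "\<lambda>a b c. mfps_nth f a * mfps_nth g b * mfps_nth h c"
    have "mfps_nth (f * g * h) m =
        (\<Sum>p\<in>{(a, b). a + b = m}. \<Sum>q\<in>{(a, b). a + b = fst p}. ?t (fst q) (snd q) (snd p))"
      by (simp add: times_mfps_def case_prod_unfold sum_distrib_right)
    also have "\<dots> = (\<Sum>(p, q)\<in>Sigma {(a, b). a + b = m} (\<lambda>p. {(a, b). a + b = fst p}).
        ?t (fst q) (snd q) (snd p))"
      by (rule sum.Sigma) (use finite_monomial_splits in auto)
    also have "\<dots> = (\<Sum>(p, q)\<in>Sigma {(a, b). a + b = m} (\<lambda>p. {(a, b). a + b = snd p}).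
        ?t (fst p) (fst q) (snd q))"
      by (rule sum.reindex_bij_witness
          [where j = "\<lambda>(p, q). ((fst q, snd q + snd p), (snd q, snd p))"
             and i = "\<lambda>(p, q). ((fst p + fst q, snd q), (fst p, fst q))"])
         (auto simp: add.assoc)
    also have "\<dots> =
        (\<Sum>p\<in>{(a, b). a + b = m}. \<Sum>q\<in>{(a, b). a + b = snd p}. ?t (fst p) (fst q) (snd q))"
      by (rule sum.Sigma[symmetric]) (use finite_monomial_splits in auto)
    also have "\<dots> = mfps_nth (f * (g * h)) m"
      by (simp add: times_mfps_def case_prod_unfold sum_distrib_left mult.assoc)
    finally show "mfps_nth (f * g * h) m = mfps_nth (f * (g * h)) m" .
  qed
qed

end

lemma mfps_nth_zero [simp]: "mfps_nth 0 m = 0"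
  and mfps_nth_one: "mfps_nth 1 m = (if m = 0 then 1 else 0)"
  and mfps_nth_add [simp]: "mfps_nth (f + g) m = mfps_nth f m + mfps_nth g m"
  and mfps_nth_minus [simp]: "mfps_nth (f - g) m = mfps_nth f m - mfps_nth g m"
  and mfps_nth_uminus [simp]: "mfps_nth (- f) m = - mfps_nth f m"
  and mfps_nth_mult: "mfps_nth (f * g) m = (\<Sum>(a, b)\<in>{(a, b). a + b = m}. mfps_nth f a * mfps_nth g b)"
  by (simp_all add: zero_mfps_def one_mfps_def plus_mfps_def minus_mfps_def uminus_mfps_def
      times_mfps_def)

text \<open>
  The witnesses are the lexicographically least elements of \<open>S\<close> and \<open>T\<close>.
\<close>

lemma least_monomials:
  fixes S T :: "('v::finite \<Rightarrow>\<^sub>0 nat) set"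
  assumes "S \<noteq> {}" "T \<noteq> {}"
  shows "\<exists>a\<in>S. \<exists>b\<in>T. \<forall>a'\<in>S. \<forall>b'\<in>T. a' + b' = a + b \<longrightarrow> a' = a \<and> b' = b"
proof -
  have *: "\<exists>a\<in>S. \<exists>b\<in>T. \<forall>a'\<in>S. \<forall>b'\<in>T. a' + b' = a + b \<longrightarrow>
      (\<forall>i\<in>V. Poly_Mapping.lookup a' i = Poly_Mapping.lookup a i \<and>
             Poly_Mapping.lookup b' i = Poly_Mapping.lookup b i)"
    if "finite V" "S \<noteq> {}" "T \<noteq> {}" for V :: "'v set" and S T :: "('v \<Rightarrow>\<^sub>0 nat) set"
    using that
  proof (induction V arbitrary: S T rule: finite_induct)
    case empty
    then show ?case by auto
  next
    case (insert v V)
    define least where "least S = (LEAST n. \<exists>a\<in>S. Poly_Mapping.lookup a v = n)"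
      for S :: "('v \<Rightarrow>\<^sub>0 nat) set"
    define cut where "cut S = {a \<in> S. Poly_Mapping.lookup a v = least S}"
      for S :: "('v \<Rightarrow>\<^sub>0 nat) set"
    have le: "least S \<le> Poly_Mapping.lookup a v" if "a \<in> S" for S a
      unfolding least_def by (rule Least_le) (use that in auto)
    have ne: "cut S \<noteq> {}" if "S \<noteq> {}" for S
    proof -
      from that obtain a where "a \<in> S" by auto
      then have "\<exists>n. \<exists>a\<in>S. Poly_Mapping.lookup a v = n" by auto
      from LeastI_ex[OF this] show ?thesis
        unfolding cut_def least_def by auto
    qed
    from insert.IH[OF ne[OF insert.prems(1)] ne[OF insert.prems(2)]]
    obtain a b where a: "a \<in> cut S" and b: "b \<in> cut T"
      and ab: "\<And>a' b'. a' \<in> cut S \<Longrightarrow> b' \<in> cut T \<Longrightarrow> a' + b' = a + b \<Longrightarrow>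
        (\<forall>i\<in>V. Poly_Mapping.lookup a' i = Poly_Mapping.lookup a i \<and>
               Poly_Mapping.lookup b' i = Poly_Mapping.lookup b i)"
      by blast
    have "\<forall>i\<in>insert v V. Poly_Mapping.lookup a' i = Poly_Mapping.lookup a i \<and>
               Poly_Mapping.lookup b' i = Poly_Mapping.lookup b i"
      if "a' \<in> S" "b' \<in> T" "a' + b' = a + b" for a' b'
    proof -
      have "Poly_Mapping.lookup a' v + Poly_Mapping.lookup b' v = least S + least T"
        using that(3) a b by (metis (mono_tags, lifting) cut_def lookup_add mem_Collect_eq)
      with le[OF that(1)] le[OF that(2)]
      have v: "Poly_Mapping.lookup a' v = least S" "Poly_Mapping.lookup b' v = least T"
        by linarith+
      then have "a' \<in> cut S" "b' \<in> cut T"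
        using that by (auto simp: cut_def)
      with ab[OF this that(3)] v a b show ?thesis
        by (auto simp: cut_def)
    qed
    with a b show ?case
      unfolding cut_def by blast
  qed
  from *[of UNIV, OF finite assms] show ?thesis
    by (metis UNIV_I poly_mapping_eqI)
qed

instance mfps :: (finite, idom) idom
proof
  fix f g :: "('a, 'b) mfps"
  assume "f \<noteq> 0" "g \<noteq> 0"
  then have "{m. mfps_nth f m \<noteq> 0} \<noteq> {}" "{m. mfps_nth g m \<noteq> 0} \<noteq> {}"
    by (auto simp: mfps_eq_iff)
  from least_monomials[OF this] obtain a b where a: "mfps_nth f a \<noteq> 0" and b: "mfps_nth g b \<noteq> 0"
    and ab: "\<And>a' b'. mfps_nth f a' \<noteq> 0 \<Longrightarrow> mfps_nth g b' \<noteq> 0 \<Longrightarrow> a' + b' = a + b \<Longrightarrow> a' = a \<and> b' = b"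
    by auto
  have "mfps_nth (f * g) (a + b) =
      (\<Sum>p\<in>{(a', b'). a' + b' = a + b}. if p = (a, b) then mfps_nth f a * mfps_nth g b else 0)"
    unfolding mfps_nth_mult using ab by (intro sum.cong) auto
  also have "\<dots> = mfps_nth f a * mfps_nth g b"
    by (simp add: finite_monomial_splits)
  finally show "f * g \<noteq> 0"
    using a b by auto
qed

definition mfps_const :: "'a::zero \<Rightarrow> ('v, 'a) mfps" where
  "mfps_const c = Abs_mfps (\<lambda>m. if m = 0 then c else 0)"

definition mfps_of_mpoly :: "('v, 'a::zero) mpoly \<Rightarrow> ('v, 'a) mfps" where
  "mfps_of_mpoly A = Abs_mfps (Poly_Mapping.lookup A)"

definition mfps_map :: "('a \<Rightarrow> 'b) \<Rightarrow> ('v, 'a) mfps \<Rightarrow> ('v, 'b) mfps" where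
  "mfps_map h f = Abs_mfps (\<lambda>m. h (mfps_nth f m))"

text \<open>
  The substitution \<open>g(x\<^sup>b)\<close> for \<open>b \<ge> 1\<close>: the coefficient of \<open>x\<^sup>m\<close> is that of \<open>x\<close> to the power
  \<open>m / b\<close> in \<open>g\<close> if \<open>b\<close> divides every entry of \<open>m\<close>, and 0 otherwise.
\<close>

definition mfps_subst_pow :: "nat \<Rightarrow> ('v, 'a::zero) mfps \<Rightarrow> ('v, 'a) mfps" where
  "mfps_subst_pow b g = Abs_mfps (\<lambda>m.
     if \<forall>i. b dvd Poly_Mapping.lookup m i then mfps_nth g (Poly_Mapping.map (\<lambda>e. e div b) m) else 0)"

text \<open>The partial degree in \<open>x\<^sub>i\<close>; the zero polynomial is given degree 0.\<close>

definition mpoly_degree_in :: "'v \<Rightarrow> ('v, 'a::zero) mpoly \<Rightarrow> nat" where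
  "mpoly_degree_in i A = Max (insert 0 ((\<lambda>m. Poly_Mapping.lookup m i) ` Poly_Mapping.keys A))"

text \<open>\<open>f \<equiv> g\<close> modulo the ideal \<open>c R[[x]]\<close> of \<open>R[[x]]\<close>, where \<open>R\<close> is a subring of the
  coefficient domain.\<close>

definition mfps_cong :: "'a::comm_ring_1 set \<Rightarrow> 'a \<Rightarrow> ('v, 'a) mfps \<Rightarrow> ('v, 'a) mfps \<Rightarrow> bool" where
  "mfps_cong R c f g \<longleftrightarrow> (\<exists>h. (\<forall>m. mfps_nth h m \<in> R) \<and> f - g = mfps_const c * h)"


section \<open>The sets \<open>\<LL>\<^sub>d\<close> and \<open>\<D>(q;g)\<close>\<close>

definition L_set :: "('v::finite, int) mfps set" where
  "L_set = {g. mfps_nth g 0 = 1 \<and>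
     (\<forall>p::nat. prime p \<longrightarrow>
        (\<exists>k\<ge>1. \<exists>A :: ('v, int) mpoly.
           (\<forall>i. mpoly_degree_in i A \<le> p ^ k - 1) \<and>
           mfps_cong UNIV (int p) g (mfps_of_mpoly A * mfps_subst_pow (p ^ k) g)))}"

text \<open>The subring \<open>\<int>[q]\<close> of \<open>\<complex>\<close>.\<close>

definition int_adjoin :: "complex \<Rightarrow> complex set" where
  "int_adjoin q = {poly (map_poly of_int P) q | P :: int poly. True}"

definition cyclotomic :: "nat \<Rightarrow> complex poly" where
  "cyclotomic b = (\<Prod>k\<in>{k\<in>{1..b}. coprime k b}. [:- cis (2 * pi * real k / real b), 1:])"

definition D_set :: "complex \<Rightarrow> ('v::finite, int) mfps \<Rightarrow> ('v, complex) mfps set" where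
  "D_set q g = {f. f \<noteq> 0 \<and> (\<forall>m. mfps_nth f m \<in> int_adjoin q) \<and>
     (\<forall>b\<ge>1. \<exists>A :: ('v, complex) mpoly.
        (\<forall>m. Poly_Mapping.lookup A m \<in> int_adjoin q) \<and>
        mfps_cong (int_adjoin q) (poly (cyclotomic b) q)
          f (mfps_of_mpoly A * mfps_subst_pow b (mfps_map of_int g)))}"


section \<open>Algebraic independence\<close>

definition mpoly_eval :: "('i \<Rightarrow> 'k::comm_ring_1) \<Rightarrow> ('i, 'k) mpoly \<Rightarrow> 'k" where
  "mpoly_eval y P = (\<Sum>m\<in>Poly_Mapping.keys P.
     Poly_Mapping.lookup P m * (\<Prod>i\<in>Poly_Mapping.keys m. y i ^ Poly_Mapping.lookup m i))"

text \<open>The family \<open>(y\<^sub>i)\<close>, \<open>i \<in> I\<close>, of elements of a field is algebraically independent over the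
  subfield \<open>K\<close>.\<close>

definition alg_independent_over :: "'k::field set \<Rightarrow> 'i set \<Rightarrow> ('i \<Rightarrow> 'k) \<Rightarrow> bool" where
  "alg_independent_over K I y \<longleftrightarrow>
     (\<forall>P :: ('i, 'k) mpoly.
        P \<noteq> 0 \<longrightarrow> (\<forall>m. Poly_Mapping.lookup P m \<in> K) \<longrightarrow>
        (\<forall>m\<in>Poly_Mapping.keys P. Poly_Mapping.keys m \<subseteq> I) \<longrightarrow> mpoly_eval y P \<noteq> 0)"

text \<open>The field \<open>\<complex>(x)\<close>, as a subfield of the field of fractions of \<open>\<complex>[[x]]\<close>.\<close>

definition rational_functions :: "('v::finite, complex) mfps fract set" where
  "rational_functions =
     {Fract (mfps_of_mpoly A) (mfps_of_mpoly B) | A B :: ('v, complex) mpoly. B \<noteq> 0}"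

text \<open>Algebraic independence over \<open>\<complex>(x)\<close> of power series in \<open>\<complex>[[x]]\<close>.\<close>

definition mfps_alg_independent :: "'i set \<Rightarrow> ('i \<Rightarrow> ('v::finite, complex) mfps) \<Rightarrow> bool" where
  "mfps_alg_independent I f \<longleftrightarrow>
     alg_independent_over rational_functions I (\<lambda>i. to_fract (f i))"

end

theory Submission
  imports Defs "HOL-Library.FuncSet" "HOL-Computational_Algebra.Primes"
begin

text \<open>
  Suppose the \<open>f\<^sub>i\<close> satisfy a polynomial relation. Elimination over \<open>\<int>[q]\<close> makes its coefficients
  polynomials over \<open>\<int>[q]\<close>, so it can be reduced modulo a ring homomorphism \<open>\<int>[q] \<rightarrow> \<int>/p\<close>, which sends \<open>q\<close>
  to some residue \<open>t \<noteq> 0\<close>; such homomorphisms exist for infinitely many primes \<open>p\<close>, without killing a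
  prescribed nonzero element. As \<open>t\<close> has finite multiplicative order, \<open>p\<close> divides \<open>\<phi>\<^sub>b(t)\<close> for some \<open>b\<close>, and
  therefore \<open>f\<^sub>i \<equiv> A\<^sub>i g\<^sub>i(x\<^sup>b)\<close> modulo \<open>p\<close> with \<open>A\<^sub>i \<noteq> 0\<close>. Sorting the exponents of the relation by their residues
  modulo \<open>b\<close> turns it into a relation of the \<open>g\<^sub>i\<close> modulo \<open>p\<close>, of the same degree in the \<open>g\<^sub>i\<close>.

  The same sorting applied to \<open>g\<^sub>i \<equiv> B\<^sub>i g\<^sub>i(x\<^sup>Q)\<close>, with \<open>Q\<close> a power of \<open>p\<close> and \<open>deg B\<^sub>i < Q\<close>, maps a relation whose
  coefficients have degree \<open>D\<close> in \<open>x\<close> to one of degree at most \<open>(D + e (Q - 1)) / Q\<close>, where \<open>e\<close> is the degree in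
  the \<open>g\<^sub>i\<close>. Iterating, \<open>D\<close> drops to \<open>e\<close>, a bound that does not depend on \<open>p\<close>. Hence a fixed finite family of
  integral power series is linearly dependent modulo infinitely many primes, and so it is linearly
  dependent over \<open>\<int>\<close>: the \<open>g\<^sub>i\<close> are algebraically dependent.
\<close>

section \<open>Power series and reduction of coefficients\<close>

lemma mfps_nth_const: "mfps_nth (mfps_const c) m = (if m = 0 then c else 0)"
  by (simp add: mfps_const_def)

lemma mfps_nth_map [simp]: "mfps_nth (mfps_map h f) m = h (mfps_nth f m)"
  by (simp add: mfps_map_def)

lemma mfps_nth_mpoly [simp]: "mfps_nth (mfps_of_mpoly A) m = Poly_Mapping.lookup A m"
  by (simp add: mfps_of_mpoly_def)

lemma mfps_nth_sum: "mfps_nth (\<Sum>i\<in>I. f i) m = (\<Sum>i\<in>I. mfps_nth (f i) m)"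
  by (induction I rule: infinite_finite_induct) simp_all

lemma mfps_nth_const_mult:
  fixes f :: "('v, 'a::comm_ring_1) mfps"
  shows "mfps_nth (mfps_const c * f) m = c * mfps_nth f m"
proof -
  have "mfps_nth (mfps_const c * f) m =
      (\<Sum>p\<in>{(a, b). a + b = m}. if p = (0, m) then c * mfps_nth f m else 0)"
    unfolding mfps_nth_mult mfps_nth_const by (rule sum.cong) (auto split: if_splits)
  then show ?thesis
    by (simp add: finite_monomial_splits)
qed

lemma mfps_const_dvd_iff:
  fixes f :: "('v, 'a::comm_ring_1) mfps"
  shows "mfps_const c dvd f \<longleftrightarrow> (\<forall>m. c dvd mfps_nth f m)"
proof
  assume "mfps_const c dvd f"
  then obtain k where "f = mfps_const c * k"
    by (elim dvdE)
  then show "\<forall>m. c dvd mfps_nth f m"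
    by (simp add: mfps_nth_const_mult)
next
  assume "\<forall>m. c dvd mfps_nth f m"
  then have "\<forall>m. \<exists>k. mfps_nth f m = c * k"
    by (auto elim: dvdE)
  from choice[OF this] obtain k where "\<forall>m. mfps_nth f m = c * k m" ..
  then have "f = mfps_const c * Abs_mfps k"
    by (intro mfps_eqI) (simp add: mfps_nth_const_mult)
  then show "mfps_const c dvd f"
    by simp
qed

text \<open>
  Since \<open>0 dvd x\<close> means \<open>x = 0\<close>, divisibility by such an element covers both vanishing in a domain and
  vanishing modulo a prime.
\<close>

definition prime_or_zero :: "'a::comm_ring_1 \<Rightarrow> bool" where
  "prime_or_zero c \<longleftrightarrow> \<not> c dvd 1 \<and> (\<forall>x y. c dvd x * y \<longrightarrow> c dvd x \<or> c dvd y)"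

text \<open>This is Gauss's lemma. Choose \<open>a + b\<close> so that it splits in only one way
  into exponents of coefficients of \<open>f\<close> and \<open>g\<close> not divisible by
  \<open>c\<close>. Every other summand of the product coefficient at \<open>a + b\<close> is
  divisible by \<open>c\<close>, which contradicts the primality of \<open>c\<close>.\<close>

lemma mfps_const_dvd_mult_iff:
  fixes f g :: "('v::finite, 'a::comm_ring_1) mfps"
  assumes prime: "prime_or_zero c"
  shows "mfps_const c dvd f * g \<longleftrightarrow> mfps_const c dvd f \<or> mfps_const c dvd g"
proof (rule iffI, rule ccontr)
  assume dvd: "mfps_const c dvd f * g" and "\<not> (mfps_const c dvd f \<or> mfps_const c dvd g)"
  then have "{m. \<not> c dvd mfps_nth f m} \<noteq> {}" "{m. \<not> c dvd mfps_nth g m} \<noteq> {}"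
    by (auto simp: mfps_const_dvd_iff)
  from least_monomials[OF this] obtain a b
    where a: "\<not> c dvd mfps_nth f a" and b: "\<not> c dvd mfps_nth g b"
      and ab: "\<And>a' b'. \<not> c dvd mfps_nth f a' \<Longrightarrow> \<not> c dvd mfps_nth g b' \<Longrightarrow> a' + b' = a + b \<Longrightarrow>
        a' = a \<and> b' = b"
    by auto
  let ?S = "{(a', b'). a' + b' = a + b}"
  have "mfps_nth (f * g) (a + b) = mfps_nth f a * mfps_nth g b +
      (\<Sum>(a', b')\<in>?S - {(a, b)}. mfps_nth f a' * mfps_nth g b')"
    unfolding mfps_nth_mult by (subst sum.remove[of _ "(a, b)"]) (auto simp: finite_monomial_splits)
  moreover have "c dvd (\<Sum>(a', b')\<in>?S - {(a, b)}. mfps_nth f a' * mfps_nth g b')"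
    using ab by (intro dvd_sum) (auto intro: dvd_mult dvd_mult2)
  moreover have "c dvd mfps_nth (f * g) (a + b)"
    using dvd by (simp add: mfps_const_dvd_iff)
  ultimately have "c dvd mfps_nth f a * mfps_nth g b"
    by (metis dvd_add_left_iff)
  then show False
    using prime a b unfolding prime_or_zero_def by blast
qed (auto intro: dvd_mult dvd_mult2)

lemma mfps_const_dvd_power:
  fixes f :: "('v::finite, 'a::comm_ring_1) mfps"
  assumes "prime_or_zero c" "mfps_const c dvd f ^ k"
  shows "mfps_const c dvd f"
  using assms(2)
proof (induction k)
  case 0
  then show ?case
    using assms(1) by (auto simp: mfps_const_dvd_iff mfps_nth_one prime_or_zero_def split: if_splits)
next
  case (Suc k)
  then show ?case
    using mfps_const_dvd_mult_iff[OF assms(1)] by auto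
qed

lemma mfps_const_dvd_prod:
  fixes f :: "'i \<Rightarrow> ('v::finite, 'a::comm_ring_1) mfps"
  assumes "prime_or_zero c" "mfps_const c dvd (\<Prod>i\<in>K. f i)"
    "finite K"
  shows "\<exists>i\<in>K. mfps_const c dvd f i"
  using assms(3,2)
proof (induction K)
  case empty
  then show ?case
    using assms(1) by (auto simp: mfps_const_dvd_iff mfps_nth_one prime_or_zero_def split: if_splits)
next
  case (insert i K)
  then show ?case
    using mfps_const_dvd_mult_iff[OF assms(1)] by auto
qed

section \<open>Ring homomorphisms on coefficients\<close>

definition ring_hom_fun :: "('a::comm_ring_1 \<Rightarrow> 'b::comm_ring_1) \<Rightarrow> bool" where
  "ring_hom_fun h \<longleftrightarrow> h 1 = 1 \<and> (\<forall>x y. h (x + y) = h x + h y) \<and> (\<forall>x y. h (x * y) = h x * h y)"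

context
  fixes h :: "'a::comm_ring_1 \<Rightarrow> 'b::comm_ring_1"
  assumes h: "ring_hom_fun h"
begin

lemma ring_hom_fun_zero: "h 0 = 0"
  using h unfolding ring_hom_fun_def by (metis add_cancel_right_left add_0)

lemma ring_hom_fun_diff: "h (x - y) = h x - h y"
  using h unfolding ring_hom_fun_def by (metis add_diff_cancel_right' diff_add_cancel)

lemma ring_hom_fun_sum: "h (sum f A) = (\<Sum>x\<in>A. h (f x))"
  using h ring_hom_fun_zero unfolding ring_hom_fun_def
  by (induction A rule: infinite_finite_induct) simp_all

lemma ring_hom_fun_prod: "h (prod f A) = (\<Prod>x\<in>A. h (f x))"
  using h unfolding ring_hom_fun_def
  by (induction A rule: infinite_finite_induct) simp_all

lemma ring_hom_fun_power: "h (x ^ k) = h x ^ k"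
  using h unfolding ring_hom_fun_def by (induction k) simp_all

lemma ring_hom_fun_mfps_map: "ring_hom_fun (mfps_map h :: ('v, 'a) mfps \<Rightarrow> ('v, 'b) mfps)"
proof -
  have "mfps_map h (1 :: ('v, 'a) mfps) = 1"
    using h ring_hom_fun_zero by (intro mfps_eqI) (simp add: mfps_nth_one ring_hom_fun_def)
  moreover have "mfps_map h (f + g) = mfps_map h f + mfps_map h g" for f g :: "('v, 'a) mfps"
    using h by (intro mfps_eqI) (simp add: ring_hom_fun_def)
  moreover have "mfps_map h (f * g) = mfps_map h f * mfps_map h g" for f g :: "('v, 'a) mfps"
    using h by (intro mfps_eqI)
      (simp add: mfps_nth_mult ring_hom_fun_sum case_prod_unfold ring_hom_fun_def)
  ultimately show ?thesis
    by (simp add: ring_hom_fun_def)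
qed

lemma mfps_map_const: "mfps_map h (mfps_const c) = mfps_const (h c)"
  by (intro mfps_eqI) (simp add: mfps_nth_const ring_hom_fun_zero)

lemma mfps_map_subst_pow: "mfps_map h (mfps_subst_pow b f) = mfps_subst_pow b (mfps_map h f)"
  by (intro mfps_eqI) (simp add: mfps_subst_pow_def ring_hom_fun_zero)

end

lemma mfps_map_mult: "ring_hom_fun h \<Longrightarrow> mfps_map h (f * g) = mfps_map h f * mfps_map h g"
  using ring_hom_fun_mfps_map unfolding ring_hom_fun_def by blast

lemma mfps_map_diff: "ring_hom_fun h \<Longrightarrow> mfps_map h (f - g) = mfps_map h f - mfps_map h g"
  by (rule ring_hom_fun_diff[OF ring_hom_fun_mfps_map])

text \<open>The product runs over \<open>K\<close> instead of the support of \<open>m\<close>, so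
  that all monomials of a relation share one index set. If \<open>K\<close> is finite and contains
  the support, this is the monomial of \<open>mpoly_eval\<close>.\<close>

definition family_pow :: "'i set \<Rightarrow> ('i \<Rightarrow> 'a::comm_ring_1) \<Rightarrow> ('i \<Rightarrow>\<^sub>0 nat) \<Rightarrow> 'a" where
  "family_pow K f m = (\<Prod>i\<in>K. f i ^ Poly_Mapping.lookup m i)"

lemma family_pow_mult: "family_pow K (\<lambda>i. f i * g i) m = family_pow K f m * family_pow K g m"
  by (simp add: family_pow_def power_mult_distrib prod.distrib)

lemma family_pow_hom: "ring_hom_fun h \<Longrightarrow> h (family_pow K f m) = family_pow K (\<lambda>i. h (f i)) m"
  by (simp add: family_pow_def ring_hom_fun_prod ring_hom_fun_power)

lemma dvd_power_diff:
  fixes x y :: "'a::comm_ring_1"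
  assumes "c dvd x - y"
  shows "c dvd x ^ k - y ^ k"
proof (induction k)
  case (Suc k)
  have "x ^ Suc k - y ^ Suc k = x * (x ^ k - y ^ k) + (x - y) * y ^ k"
    by (simp add: algebra_simps)
  then show ?case
    using Suc assms by (metis dvd_add dvd_mult dvd_mult2)
qed simp

lemma dvd_prod_diff:
  fixes x y :: "'i \<Rightarrow> 'a::comm_ring_1"
  assumes "\<And>i. i \<in> K \<Longrightarrow> c dvd x i - y i"
  shows "c dvd (\<Prod>i\<in>K. x i) - (\<Prod>i\<in>K. y i)"
  using assms
proof (induction K rule: infinite_finite_induct)
  case (insert i K)
  have "(\<Prod>i\<in>insert i K. x i) - (\<Prod>i\<in>insert i K. y i) =
      x i * ((\<Prod>i\<in>K. x i) - (\<Prod>i\<in>K. y i)) + (x i - y i) * (\<Prod>i\<in>K. y i)"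
    using insert.hyps by (simp add: algebra_simps)
  then show ?case
    using insert by (metis dvd_add dvd_mult dvd_mult2 insertCI)
qed simp_all

lemma family_pow_diff:
  assumes "\<And>i. i \<in> K \<Longrightarrow> c dvd x i - y i"
  shows "c dvd family_pow K x m - family_pow K y m"
  unfolding family_pow_def by (intro dvd_prod_diff dvd_power_diff assms)

lemma not_const_dvd_family_pow:
  fixes f :: "'i \<Rightarrow> ('v::finite, 'a::comm_ring_1) mfps"
  assumes "prime_or_zero c" "finite K"
    and "\<And>i. i \<in> K \<Longrightarrow> \<not> mfps_const c dvd f i"
  shows "\<not> mfps_const c dvd family_pow K f m"
proof
  assume "mfps_const c dvd family_pow K f m"
  then obtain i where "i \<in> K" "mfps_const c dvd f i ^ Poly_Mapping.lookup m i"
    using mfps_const_dvd_prod[OF assms(1) _ assms(2)] unfolding family_pow_def by blast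
  with mfps_const_dvd_power[OF assms(1)] assms(3) show False
    by blast
qed

section \<open>Degree bounds and boxes of exponents\<close>

text \<open>Polynomials are kept inside the ring of power series; in finitely many indeterminates
  this bound forces \<open>f\<close> to be one. It bounds each partial degree separately, as in
  \<open>L_set\<close>.\<close>

definition deg_le :: "nat \<Rightarrow> ('v, 'a::zero) mfps \<Rightarrow> bool" where
  "deg_le D f \<longleftrightarrow> (\<forall>m. mfps_nth f m \<noteq> 0 \<longrightarrow> (\<forall>i. Poly_Mapping.lookup m i \<le> D))"

lemma deg_le_mono: "deg_le D f \<Longrightarrow> D \<le> E \<Longrightarrow> deg_le E f"
  unfolding deg_le_def by (meson le_trans)

lemma deg_le_one: "deg_le D (1 :: ('v, 'a::comm_ring_1) mfps)"
  by (auto simp: deg_le_def mfps_nth_one split: if_splits)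

lemma deg_le_mult:
  fixes f g :: "('v, 'a::comm_ring_1) mfps"
  assumes "deg_le D f" "deg_le E g"
  shows "deg_le (D + E) (f * g)"
  unfolding deg_le_def
proof (intro allI impI)
  fix m i
  assume "mfps_nth (f * g) m \<noteq> 0"
  then obtain a b where "a + b = m" "mfps_nth f a * mfps_nth g b \<noteq> 0"
    unfolding mfps_nth_mult by (auto elim!: sum.not_neutral_contains_not_neutral)
  moreover from this have "mfps_nth f a \<noteq> 0" "mfps_nth g b \<noteq> 0"
    by auto
  ultimately show "Poly_Mapping.lookup m i \<le> D + E"
    using assms by (auto simp: deg_le_def lookup_add intro!: add_mono)
qed

lemma deg_le_power:
  fixes f :: "('v, 'a::comm_ring_1) mfps"
  assumes "deg_le D f"
  shows "deg_le (k * D) (f ^ k)"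
  by (induction k) (use assms deg_le_mult in \<open>auto simp: deg_le_one\<close>)

lemma deg_le_prod:
  fixes f :: "'i \<Rightarrow> ('v, 'a::comm_ring_1) mfps"
  assumes "\<And>i. i \<in> K \<Longrightarrow> deg_le (D i) (f i)"
  shows "deg_le (sum D K) (prod f K)"
  using assms by (induction K rule: infinite_finite_induct) (auto simp: deg_le_one intro: deg_le_mult)

lemma deg_le_family_pow:
  fixes f :: "'i \<Rightarrow> ('v, 'a::comm_ring_1) mfps"
  assumes "\<And>i. i \<in> K \<Longrightarrow> deg_le D (f i)"
  shows "deg_le ((\<Sum>i\<in>K. Poly_Mapping.lookup m i) * D) (family_pow K f m)"
  unfolding family_pow_def sum_distrib_right by (intro deg_le_prod deg_le_power assms)

lemma deg_le_mfps_of_mpoly: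
  fixes A :: "('v::finite, 'a::zero) mpoly"
  assumes "\<And>i. mpoly_degree_in i A \<le> D"
  shows "deg_le D (mfps_of_mpoly A)"
  unfolding deg_le_def
proof (intro allI impI)
  fix m i
  assume "mfps_nth (mfps_of_mpoly A) m \<noteq> 0"
  then have "Poly_Mapping.lookup m i \<le> mpoly_degree_in i A"
    unfolding mpoly_degree_in_def by (intro Max_ge) (auto simp: in_keys_iff)
  then show "Poly_Mapping.lookup m i \<le> D"
    using assms le_trans by blast
qed

lemma deg_le_mpoly_ex:
  fixes A :: "('v::finite, 'a::zero) mpoly"
  shows "\<exists>D. deg_le D (mfps_of_mpoly A)"
  by (rule exI[of _ "Max (range (\<lambda>i. mpoly_degree_in i A))"]) (rule deg_le_mfps_of_mpoly, simp)

definition monomial_box :: "nat \<Rightarrow> ('v \<Rightarrow>\<^sub>0 nat) set" where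
  "monomial_box D = {m. \<forall>i. Poly_Mapping.lookup m i \<le> D}"

lemma finite_monomial_box: "finite (monomial_box D :: ('v::finite \<Rightarrow>\<^sub>0 nat) set)"
proof -
  have "finite (PiE (UNIV :: 'v set) (\<lambda>_. {..D}))"
    by (rule finite_PiE) auto
  from finite_vimageI[OF this, of Poly_Mapping.lookup] show ?thesis
    by (simp add: monomial_box_def vimage_def inj_def poly_mapping_eqI PiE_def Pi_def)
qed

lemma deg_le_iff: "deg_le D f \<longleftrightarrow> (\<forall>m. m \<notin> monomial_box D \<longrightarrow> mfps_nth f m = 0)"
  by (auto simp: deg_le_def monomial_box_def)

lemma deg_le_imp_mpoly:
  fixes f :: "('v::finite, 'a::zero) mfps"
  assumes "deg_le D f"
  shows "\<exists>A. f = mfps_of_mpoly A"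
proof -
  have "finite {m. mfps_nth f m \<noteq> 0}"
    by (rule finite_subset[OF _ finite_monomial_box[of D]]) (use assms in \<open>auto simp: deg_le_iff\<close>)
  then have "mfps_of_mpoly (Abs_poly_mapping (mfps_nth f)) = f"
    by (intro mfps_eqI) simp
  then show ?thesis by metis
qed

definition mfps_monom :: "('v \<Rightarrow>\<^sub>0 nat) \<Rightarrow> ('v, 'a::zero_neq_one) mfps" where
  "mfps_monom s = Abs_mfps (\<lambda>m. if m = s then 1 else 0)"

lemma mfps_eq_sum_monom:
  fixes c :: "('v::finite, 'a::comm_ring_1) mfps"
  assumes "deg_le D c"
  shows "c = (\<Sum>s\<in>monomial_box D. mfps_const (mfps_nth c s) * mfps_monom s)"
proof (rule mfps_eqI)
  fix m
  have "(\<Sum>s\<in>monomial_box D. mfps_nth c s * mfps_nth (mfps_monom s) m) =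
      (\<Sum>s\<in>monomial_box D. if s = m then mfps_nth c m else 0)"
    by (intro sum.cong) (auto simp: mfps_monom_def)
  also have "\<dots> = mfps_nth c m"
    using assms by (simp add: finite_monomial_box deg_le_iff)
  finally show "mfps_nth c m =
      mfps_nth (\<Sum>s\<in>monomial_box D. mfps_const (mfps_nth c s) * mfps_monom s) m"
    by (simp add: mfps_nth_sum mfps_nth_const_mult)
qed

text \<open>A relation with polynomial coefficients of bounded degree becomes a linear dependence,
  with scalar coefficients, of the series \<open>mfps_monom s * F m\<close>. For finite
  \<open>S\<close> these are finitely many, so elimination applies.\<close>

lemma mfps_nth_linear_combination:
  fixes F :: "'m \<Rightarrow> ('v::finite, 'a::comm_ring_1) mfps"
  assumes "\<And>m. m \<in> S \<Longrightarrow> deg_le D (c m)"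
  shows "mfps_nth (\<Sum>m\<in>S. c m * F m) x =
    (\<Sum>(s, m)\<in>monomial_box D \<times> S. mfps_nth (c m) s * mfps_nth (mfps_monom s * F m) x)"
proof -
  have "mfps_nth (c m * F m) x =
      (\<Sum>s\<in>monomial_box D. mfps_nth (c m) s * mfps_nth (mfps_monom s * F m) x)" if "m \<in> S" for m
    by (subst mfps_eq_sum_monom[OF assms[OF that]])
       (simp add: sum_distrib_right mult.assoc mfps_nth_sum mfps_nth_const_mult)
  then show ?thesis
    by (simp add: mfps_nth_sum sum.cartesian_product[symmetric] sum.swap[of _ S])
qed

section \<open>Sections of power series along residue classes of exponents\<close>

definition monom_scale :: "nat \<Rightarrow> ('v \<Rightarrow>\<^sub>0 nat) \<Rightarrow> ('v \<Rightarrow>\<^sub>0 nat)" where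
  "monom_scale b m = Poly_Mapping.map (\<lambda>e. b * e) m"

lemma lookup_monom_scale [simp]:
  "Poly_Mapping.lookup (monom_scale b m) i = b * Poly_Mapping.lookup m i"
  by (simp add: monom_scale_def Poly_Mapping.map.rep_eq when_def)

lemma lookup_map_div [simp]:
  "Poly_Mapping.lookup (Poly_Mapping.map (\<lambda>e. e div b) m) i = Poly_Mapping.lookup m i div (b::nat)"
  by (simp add: Poly_Mapping.map.rep_eq when_def)

lemma lookup_map_mod [simp]:
  "Poly_Mapping.lookup (Poly_Mapping.map (\<lambda>e. e mod b) m) i = Poly_Mapping.lookup m i mod (b::nat)"
  by (simp add: Poly_Mapping.map.rep_eq when_def)

lemma monom_scale_add: "monom_scale b (m + m') = monom_scale b m + monom_scale b m'"
  by (rule poly_mapping_eqI) (simp add: lookup_add algebra_simps)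

lemma monom_scale_zero [simp]: "monom_scale b 0 = 0"
  by (rule poly_mapping_eqI) simp

lemma monom_scale_inject: "b > 0 \<Longrightarrow> monom_scale b m = monom_scale b m' \<longleftrightarrow> m = m'"
  by (auto simp: poly_mapping_eq_iff fun_eq_iff)

lemma map_div_monom_scale: "b > 0 \<Longrightarrow> Poly_Mapping.map (\<lambda>e. e div b) (monom_scale b m) = m"
  by (rule poly_mapping_eqI) simp

lemma monom_scale_map_div:
  assumes "\<forall>i. b dvd Poly_Mapping.lookup m i"
  shows "monom_scale b (Poly_Mapping.map (\<lambda>e. e div b) m) = m"
  using assms by (intro poly_mapping_eqI) simp

lemma monom_div_mod:
  "monom_scale b (Poly_Mapping.map (\<lambda>e. e div b) m) + Poly_Mapping.map (\<lambda>e. e mod b) m = m"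
  by (rule poly_mapping_eqI) (simp add: lookup_add)

lemma mfps_nth_subst_pow_scale:
  "b > 0 \<Longrightarrow> mfps_nth (mfps_subst_pow b g) (monom_scale b m) = mfps_nth g m"
  by (simp add: mfps_subst_pow_def map_div_monom_scale)

text \<open>For \<open>b\<close> equal to a prime these are the Cartier operators.\<close>

definition mfps_section :: "nat \<Rightarrow> ('v \<Rightarrow>\<^sub>0 nat) \<Rightarrow> ('v, 'a) mfps \<Rightarrow> ('v, 'a) mfps" where
  "mfps_section b r f = Abs_mfps (\<lambda>m. mfps_nth f (monom_scale b m + r))"

lemma mfps_nth_section [simp]: "mfps_nth (mfps_section b r f) m = mfps_nth f (monom_scale b m + r)"
  by (simp add: mfps_section_def)

lemma mfps_section_sum: "mfps_section b r (\<Sum>i\<in>I. f i) = (\<Sum>i\<in>I. mfps_section b r (f i))"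
  by (rule mfps_eqI) (simp add: mfps_nth_sum)

text \<open>The exponents of the second factor are multiples \<open>b c\<close>. From
  \<open>u + b c = b m + r\<close> and \<open>r < b\<close> it follows that
  \<open>c \<le> m\<close>, hence \<open>u = b (m - c) + r\<close>: only the section of
  \<open>f\<close> at the same residue \<open>r\<close> contributes.\<close>

lemma mfps_section_mult_subst_pow:
  fixes f g :: "('v, 'a::comm_ring_1) mfps"
  assumes r: "\<And>i. Poly_Mapping.lookup r i < b"
  shows "mfps_section b r (f * mfps_subst_pow b g) = mfps_section b r f * g"
proof (rule mfps_eqI)
  fix m :: "'v \<Rightarrow>\<^sub>0 nat"
  let ?T = "{(u, v). u + v = monom_scale b m + r}"
  let ?\<phi> = "\<lambda>(a, c). (monom_scale b a + r, monom_scale b c)"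
  have b: "b > 0"
    using r by (metis gr_zeroI not_less_zero)
  have zero: "mfps_nth f u * mfps_nth (mfps_subst_pow b g) v = 0"
    if uv: "(u, v) \<in> ?T - ?\<phi> ` {(a, c). a + c = m}" for u v
  proof (cases "\<forall>i. b dvd Poly_Mapping.lookup v i")
    case True
    define c where "c = Poly_Mapping.map (\<lambda>e. e div b) v"
    have v: "v = monom_scale b c"
      using monom_scale_map_div[OF True] by (simp add: c_def)
    have eq: "Poly_Mapping.lookup u i + b * Poly_Mapping.lookup c i =
        b * Poly_Mapping.lookup m i + Poly_Mapping.lookup r i" for i
      using uv v by (auto simp: poly_mapping_eq_iff fun_eq_iff lookup_add)
    have le: "Poly_Mapping.lookup c i \<le> Poly_Mapping.lookup m i" for i
    proof -
      have "b * Poly_Mapping.lookup c i < b * (Poly_Mapping.lookup m i + 1)"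
        using eq[of i] r[of i] by (simp add: algebra_simps)
      then show ?thesis
        unfolding mult_less_cancel1 by simp
    qed
    have "m = (m - c) + c"
      by (rule poly_mapping_eqI) (use le in \<open>simp add: lookup_add lookup_minus\<close>)
    moreover have "u = monom_scale b (m - c) + r"
    proof (rule poly_mapping_eqI)
      fix i
      show "Poly_Mapping.lookup u i = Poly_Mapping.lookup (monom_scale b (m - c) + r) i"
        using eq[of i] le[of i] mult_le_mono2[OF le[of i], of b]
        by (simp add: lookup_add lookup_minus diff_mult_distrib2)
    qed
    ultimately have "(u, v) \<in> ?\<phi> ` {(a, c). a + c = m}"
      using v by (intro image_eqI[of _ _ "(m - c, c)"]) auto
    with uv show ?thesis by blast
  qed (auto simp: mfps_subst_pow_def)
  have "mfps_nth (mfps_section b r (f * mfps_subst_pow b g)) m =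
      (\<Sum>(u, v)\<in>?\<phi> ` {(a, c). a + c = m}. mfps_nth f u * mfps_nth (mfps_subst_pow b g) v)"
    unfolding mfps_nth_section mfps_nth_mult
    by (rule sum.mono_neutral_right)
       (use zero in \<open>auto simp: finite_monomial_splits monom_scale_add algebra_simps\<close>)
  also have "\<dots> = (\<Sum>p\<in>{(a, c). a + c = m}. mfps_nth f (monom_scale b (fst p) + r) * mfps_nth g (snd p))"
    by (subst sum.reindex)
       (auto simp: inj_on_def monom_scale_inject[OF b] mfps_nth_subst_pow_scale[OF b] case_prod_unfold)
  finally show "mfps_nth (mfps_section b r (f * mfps_subst_pow b g)) m =
      mfps_nth (mfps_section b r f * g) m"
    by (simp add: mfps_nth_mult case_prod_unfold)
qed

text \<open>Division with remainder of the exponents shows that the sections determine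
  \<open>f\<close>. This serves to compare series section by section and to find a section that does
  not vanish modulo a prime.\<close>

lemma mfps_nth_eq_section:
  "mfps_nth f m = mfps_nth (mfps_section b (Poly_Mapping.map (\<lambda>e. e mod b) m) f)
     (Poly_Mapping.map (\<lambda>e. e div b) m)"
  by (simp add: monom_div_mod)

lemma mfps_section_subst_pow:
  assumes "\<And>i. Poly_Mapping.lookup r i < b"
  shows "mfps_section b r (mfps_subst_pow b f) = (if r = 0 then f else 0)"
proof (rule mfps_eqI)
  fix m
  have b: "b > 0"
    using assms by (metis gr_zeroI not_less_zero)
  have "r = 0" if dvd: "\<forall>i. b dvd Poly_Mapping.lookup (monom_scale b m + r) i"
  proof (rule poly_mapping_eqI)
    fix i
    have "b dvd Poly_Mapping.lookup r i"
      using dvd by (simp add: lookup_add dvd_add_right_iff)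
    then show "Poly_Mapping.lookup r i = Poly_Mapping.lookup 0 i"
      using assms[of i] by (auto dest: dvd_imp_le)
  qed
  then show "mfps_nth (mfps_section b r (mfps_subst_pow b f)) m = mfps_nth (if r = 0 then f else 0) m"
    using mfps_nth_subst_pow_scale[OF b, of f m] by (auto simp: mfps_subst_pow_def)
qed

text \<open>Multiplicativity is checked on sections: on both sides the section at residue 0 is
  \<open>f * g\<close>, and all others vanish.\<close>

lemma ring_hom_fun_mfps_subst_pow:
  assumes b: "b > 0"
  shows "ring_hom_fun (mfps_subst_pow b :: ('v, 'a::comm_ring_1) mfps \<Rightarrow> ('v, 'a) mfps)"
proof -
  have "mfps_subst_pow b (1 :: ('v, 'a) mfps) = 1"
  proof (rule mfps_eqI)
    fix m :: "'v \<Rightarrow>\<^sub>0 nat"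
    have "Poly_Mapping.map (\<lambda>e. e div b) m = 0 \<longleftrightarrow> m = 0" if "\<forall>i. b dvd Poly_Mapping.lookup m i"
      using monom_scale_map_div[OF that] map_div_monom_scale[OF b, of 0] by auto
    then show "mfps_nth (mfps_subst_pow b 1) m = mfps_nth 1 m"
      by (auto simp: mfps_subst_pow_def mfps_nth_one)
  qed
  moreover have "mfps_subst_pow b (f + g) = mfps_subst_pow b f + mfps_subst_pow b g"
    for f g :: "('v, 'a) mfps"
    by (rule mfps_eqI) (simp add: mfps_subst_pow_def)
  moreover have "mfps_subst_pow b (f * g) = mfps_subst_pow b f * mfps_subst_pow b g"
    for f g :: "('v, 'a) mfps"
  proof (rule mfps_eqI)
    fix m :: "'v \<Rightarrow>\<^sub>0 nat"
    have r: "Poly_Mapping.lookup (Poly_Mapping.map (\<lambda>e. e mod b) m) i < b" for i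
      using b by simp
    show "mfps_nth (mfps_subst_pow b (f * g)) m =
        mfps_nth (mfps_subst_pow b f * mfps_subst_pow b g) m"
      unfolding mfps_nth_eq_section[of _ m b] mfps_section_mult_subst_pow[OF r]
        mfps_section_subst_pow[OF r]
      by simp
  qed
  ultimately show ?thesis
    by (simp add: ring_hom_fun_def)
qed

lemma mfps_subst_pow_subst_pow:
  fixes f :: "('v, 'a::zero) mfps"
  assumes "a > 0" "b > 0"
  shows "mfps_subst_pow a (mfps_subst_pow b f) = mfps_subst_pow (a * b) f"
proof (rule mfps_eqI)
  fix m :: "'v \<Rightarrow>\<^sub>0 nat"
  have *: "a * b dvd e \<longleftrightarrow> a dvd e \<and> b dvd e div a" for e :: nat
    using assms by (auto simp: dvd_div_iff_mult dvd_mult_left mult.commute)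
  have "Poly_Mapping.map (\<lambda>e. e div b) (Poly_Mapping.map (\<lambda>e. e div a) m) =
      Poly_Mapping.map (\<lambda>e. e div (a * b)) m"
    by (rule poly_mapping_eqI) (simp add: Poly_Mapping.map.rep_eq when_def div_mult2_eq)
  then show "mfps_nth (mfps_subst_pow a (mfps_subst_pow b f)) m =
      mfps_nth (mfps_subst_pow (a * b) f) m"
    by (auto simp: mfps_subst_pow_def *)
qed

lemma deg_le_subst_pow:
  assumes "deg_le D f"
  shows "deg_le (b * D) (mfps_subst_pow b f)"
  unfolding deg_le_def
proof (intro allI impI)
  fix m i
  assume nz: "mfps_nth (mfps_subst_pow b f) m \<noteq> 0"
  then have "\<forall>i. b dvd Poly_Mapping.lookup m i"
    by (auto simp: mfps_subst_pow_def split: if_splits)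
  moreover from this nz have "Poly_Mapping.lookup m i div b \<le> D"
    using assms by (auto simp: mfps_subst_pow_def deg_le_def)
  ultimately show "Poly_Mapping.lookup m i \<le> b * D"
    by (metis dvd_mult_div_cancel mult_le_mono2)
qed

lemma deg_le_section:
  assumes "deg_le D f" "b > 0"
  shows "deg_le (D div b) (mfps_section b r f)"
  unfolding deg_le_def
proof (intro allI impI)
  fix m i
  assume "mfps_nth (mfps_section b r f) m \<noteq> 0"
  then have "b * Poly_Mapping.lookup m i + Poly_Mapping.lookup r i \<le> D"
    using assms(1) by (auto simp: deg_le_def lookup_add)
  then show "Poly_Mapping.lookup m i \<le> D div b"
    using assms(2) by (simp add: less_eq_div_iff_mult_less_eq mult.commute)
qed

section \<open>Sections of relations modulo a prime\<close>

text \<open>Substituting the congruences turns the relation into one between the monomials in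
  \<open>G\<close> at \<open>x^b\<close>, with coefficients
  \<open>H m = c m * family_pow K A m\<close>. A section strips off the power \<open>b\<close>,
  leaves the exponents in \<open>S\<close> unchanged and divides the degree bound
  \<open>D + E\<close> by \<open>b\<close>.\<close>

lemma section_relation:
  fixes F G A :: "'i \<Rightarrow> ('v::finite, 'a::comm_ring_1) mfps"
  assumes p: "prime_or_zero p" and b: "b > 0" and K: "finite K"
    and cong: "\<And>i. i \<in> K \<Longrightarrow> mfps_const p dvd F i - A i * mfps_subst_pow b (G i)"
    and A: "\<And>i. i \<in> K \<Longrightarrow> \<not> mfps_const p dvd A i"
    and rel: "mfps_const p dvd (\<Sum>m\<in>S. c m * family_pow K F m)"
    and nz: "\<exists>m\<in>S. \<not> mfps_const p dvd c m"
    and deg: "\<And>m. m \<in> S \<Longrightarrow> deg_le D (c m)" "\<And>m. m \<in> S \<Longrightarrow> deg_le E (family_pow K A m)"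
  shows "\<exists>c'. mfps_const p dvd (\<Sum>m\<in>S. c' m * family_pow K G m) \<and>
    (\<exists>m\<in>S. \<not> mfps_const p dvd c' m) \<and> (\<forall>m\<in>S. deg_le ((D + E) div b) (c' m))"
proof -
  define H where "H m = c m * family_pow K A m" for m
  have "mfps_const p dvd c m * family_pow K F m - H m * mfps_subst_pow b (family_pow K G m)" for m
  proof -
    have "c m * family_pow K F m - H m * mfps_subst_pow b (family_pow K G m) =
        c m * (family_pow K F m - family_pow K (\<lambda>i. A i * mfps_subst_pow b (G i)) m)"
      by (simp add: H_def family_pow_mult family_pow_hom[OF ring_hom_fun_mfps_subst_pow[OF b]]
          algebra_simps)
    moreover have "mfps_const p dvd
        family_pow K F m - family_pow K (\<lambda>i. A i * mfps_subst_pow b (G i)) m"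
      by (rule family_pow_diff[OF cong])
    ultimately show ?thesis
      by simp
  qed
  then have "mfps_const p dvd (\<Sum>m\<in>S. c m * family_pow K F m) -
      (\<Sum>m\<in>S. H m * mfps_subst_pow b (family_pow K G m))"
    unfolding sum_subtractf[symmetric] by (intro dvd_sum) auto
  from dvd_diff[OF rel this]
  have dvd: "mfps_const p dvd (\<Sum>m\<in>S. H m * mfps_subst_pow b (family_pow K G m))"
    by (simp only: diff_diff_eq2 add_diff_cancel_left')
  obtain m0 where m0: "m0 \<in> S" "\<not> mfps_const p dvd c m0"
    using nz by blast
  moreover have "\<not> mfps_const p dvd family_pow K A m0"
    by (rule not_const_dvd_family_pow[OF p K A])
  ultimately have "\<not> mfps_const p dvd H m0"
    by (simp add: H_def mfps_const_dvd_mult_iff[OF p])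
  then obtain x where x: "\<not> p dvd mfps_nth (H m0) x"
    by (auto simp: mfps_const_dvd_iff)
  \<comment> \<open>The residue class is that of an exponent at which \<open>H m0\<close> survives
    modulo \<open>p\<close>; this keeps the new relation nontrivial.\<close>
  define r where "r = Poly_Mapping.map (\<lambda>e. e mod b) x"
  have r: "Poly_Mapping.lookup r i < b" for i
    using b by (simp add: r_def)
  have "mfps_section b r (\<Sum>m\<in>S. H m * mfps_subst_pow b (family_pow K G m)) =
      (\<Sum>m\<in>S. mfps_section b r (H m) * family_pow K G m)"
    by (simp add: mfps_section_sum mfps_section_mult_subst_pow[OF r])
  moreover have "mfps_const p dvd mfps_section b r (\<Sum>m\<in>S. H m * mfps_subst_pow b (family_pow K G m))"
    using dvd by (auto simp: mfps_const_dvd_iff)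
  moreover have "\<not> mfps_const p dvd mfps_section b r (H m0)"
    using x mfps_nth_eq_section[of "H m0" x b] unfolding mfps_const_dvd_iff r_def by metis
  moreover have "deg_le ((D + E) div b) (mfps_section b r (H m))" if "m \<in> S" for m
    unfolding H_def using that deg b by (intro deg_le_section deg_le_mult)
  ultimately show ?thesis
    using m0 by (intro exI[of _ "\<lambda>m. mfps_section b r (H m)"]) auto
qed

text \<open>Here \<open>section_relation\<close> is applied with \<open>F = G\<close>. Monomials in
  \<open>A\<close> have degree at most \<open>e * (Q - 1)\<close>, so a bound \<open>D\<close> is
  replaced by \<open>(D + e * (Q - 1)) div Q\<close>, which is smaller than \<open>D\<close> as long
  as \<open>D > e\<close>.\<close>

lemma reduce_degree_relation:
  fixes G A :: "'i \<Rightarrow> ('v::finite, 'a::comm_ring_1) mfps"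
  assumes p: "prime_or_zero p" and Q: "Q > 1" and K: "finite K"
    and cong: "\<And>i. i \<in> K \<Longrightarrow> mfps_const p dvd G i - A i * mfps_subst_pow Q (G i)"
    and A: "\<And>i. i \<in> K \<Longrightarrow> \<not> mfps_const p dvd A i" "\<And>i. i \<in> K \<Longrightarrow> deg_le (Q - 1) (A i)"
    and e: "\<And>m. m \<in> S \<Longrightarrow> (\<Sum>i\<in>K. Poly_Mapping.lookup m i) \<le> e"
    and rel: "mfps_const p dvd (\<Sum>m\<in>S. c m * family_pow K G m)"
    and nz: "\<exists>m\<in>S. \<not> mfps_const p dvd c m"
    and deg: "\<And>m. m \<in> S \<Longrightarrow> deg_le D (c m)"
  shows "\<exists>c'. mfps_const p dvd (\<Sum>m\<in>S. c' m * family_pow K G m) \<and>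
    (\<exists>m\<in>S. \<not> mfps_const p dvd c' m) \<and> (\<forall>m\<in>S. deg_le e (c' m))"
  using rel nz deg
proof (induction D arbitrary: c rule: less_induct)
  case (less D)
  show ?case
  proof (cases "D \<le> e")
    case True
    then show ?thesis
      using less.prems deg_le_mono by blast
  next
    case False
    have E: "deg_le (e * (Q - 1)) (family_pow K A m)" if "m \<in> S" for m
      by (rule deg_le_mono[OF deg_le_family_pow[OF A(2)]]) (use e[OF that] in simp_all)
    have "0 < Q"
      using Q by simp
    from section_relation[OF p this K cong A(1) less.prems E]
    obtain c' where c': "mfps_const p dvd (\<Sum>m\<in>S. c' m * family_pow K G m)"
      "\<exists>m\<in>S. \<not> mfps_const p dvd c' m" "\<And>m. m \<in> S \<Longrightarrow> deg_le ((D + e * (Q - 1)) div Q) (c' m)"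
      by blast
    have "e * (Q - 1) < D * (Q - 1)"
      using False Q by simp
    then have "D + e * (Q - 1) < D * Q"
      using Q by (cases Q) auto
    then have "(D + e * (Q - 1)) div Q < D"
      by (simp add: less_mult_imp_div_less)
    from less.IH[OF this c'] show ?thesis .
  qed
qed

section \<open>Congruences of Lucas type\<close>

text \<open>The congruence of \<open>L_set\<close> is stated for a single modulus and a single step
  \<open>Q\<close>, so that it can be iterated to powers of \<open>Q\<close>.\<close>

definition lucas_at :: "int \<Rightarrow> nat \<Rightarrow> ('v, int) mfps \<Rightarrow> bool" where
  "lucas_at p Q g \<longleftrightarrow>
     (\<exists>A. deg_le (Q - 1) A \<and> mfps_const p dvd g - A * mfps_subst_pow Q g)"

lemma L_set_lucas_at:
  assumes "g \<in> L_set" "prime p"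
  shows "\<exists>k\<ge>1. lucas_at (int p) (p ^ k) g"
proof -
  from assms obtain k A where k: "k \<ge> 1" and A: "\<And>i. mpoly_degree_in i A \<le> p ^ k - 1"
    and cong: "mfps_cong UNIV (int p) g (mfps_of_mpoly A * mfps_subst_pow (p ^ k) g)"
    unfolding L_set_def by blast
  from cong have "mfps_const (int p) dvd g - mfps_of_mpoly A * mfps_subst_pow (p ^ k) g"
    unfolding mfps_cong_def by force
  with k deg_le_mfps_of_mpoly[OF A] show ?thesis
    unfolding lucas_at_def by blast
qed

text \<open>Inserting the congruence for \<open>Q'\<close>, taken at \<open>x^Q\<close>, into the
  one for \<open>Q\<close> gives the factor \<open>A(x) A'(x^Q)\<close>. Its degree is at most
  \<open>(Q - 1) + Q * (Q' - 1) = Q * Q' - 1\<close>, exactly the bound required.\<close>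

lemma lucas_at_mult:
  assumes "lucas_at p Q g" "lucas_at p Q' g" "Q > 0" "Q' > 0"
  shows "lucas_at p (Q * Q') g"
proof -
  obtain A A' where A: "deg_le (Q - 1) A" "mfps_const p dvd g - A * mfps_subst_pow Q g"
    and A': "deg_le (Q' - 1) A'" "mfps_const p dvd g - A' * mfps_subst_pow Q' g"
    using assms unfolding lucas_at_def by blast
  note hom = ring_hom_fun_mfps_subst_pow[OF assms(3), unfolded ring_hom_fun_def]
    ring_hom_fun_diff[OF ring_hom_fun_mfps_subst_pow[OF assms(3)]]
  have "deg_le ((Q - 1) + Q * (Q' - 1)) (A * mfps_subst_pow Q A')"
    by (intro deg_le_mult deg_le_subst_pow A A')
  moreover have "(Q - 1) + Q * (Q' - 1) = Q * Q' - 1"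
    using assms(3,4) by (cases Q; cases Q') auto
  moreover have "mfps_const p dvd mfps_subst_pow Q (g - A' * mfps_subst_pow Q' g)"
    using A'(2) by (simp add: mfps_const_dvd_iff mfps_subst_pow_def)
  then have "mfps_const p dvd
      (g - A * mfps_subst_pow Q g) + A * mfps_subst_pow Q (g - A' * mfps_subst_pow Q' g)"
    using A(2) by (intro dvd_add dvd_mult)
  then have "mfps_const p dvd g - A * mfps_subst_pow Q A' * mfps_subst_pow (Q * Q') g"
    using assms(3,4) by (simp add: hom mfps_subst_pow_subst_pow algebra_simps)
  ultimately show ?thesis
    unfolding lucas_at_def by (metis (no_types, lifting))
qed

lemma lucas_at_power:
  assumes "lucas_at p Q g" "Q > 0" "j \<ge> 1"
  shows "lucas_at p (Q ^ j) g"
  using assms(3)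
proof (induction j rule: dec_induct)
  case (step j)
  then show ?case
    using lucas_at_mult[OF assms(1) step.IH] assms(2) by simp
qed (use assms(1) in simp)

text \<open>The exponent provided by \<open>L_set\<close> depends on the series. Iteration makes
  every multiple of an exponent admissible, so a product of exponents serves all members of the
  family.\<close>

lemma L_set_common_lucas_at:
  fixes g :: "'i \<Rightarrow> ('v::finite, int) mfps"
  assumes "finite K" "\<And>i. i \<in> K \<Longrightarrow> g i \<in> L_set" "prime p"
  shows "\<exists>k\<ge>1. \<forall>i\<in>K. lucas_at (int p) (p ^ k) (g i)"
  using assms(1,2)
proof (induction K)
  case (insert i K)
  obtain k where k: "k \<ge> 1" "\<forall>i\<in>K. lucas_at (int p) (p ^ k) (g i)"
    using insert by auto
  obtain l where l: "l \<ge> 1" "lucas_at (int p) (p ^ l) (g i)"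
    using L_set_lucas_at[OF _ assms(3)] insert.prems by blast
  have p: "p ^ k > 0" "p ^ l > 0"
    using assms(3) by (simp_all add: prime_gt_0_nat)
  have "\<forall>j\<in>insert i K. lucas_at (int p) (p ^ (k * l)) (g j)"
    using lucas_at_power[OF _ p(1) l(1)] lucas_at_power[OF l(2) p(2) k(1)] k(2)
    by (auto simp: power_mult[symmetric] mult.commute)
  then show ?case
    using k(1) l(1) by (intro exI[of _ "k * l"]) auto
qed auto

lemma L_set_reduce_degree:
  fixes g :: "'i \<Rightarrow> ('v::finite, int) mfps"
  assumes p: "prime p" and K: "finite K" and L: "\<And>i. i \<in> K \<Longrightarrow> g i \<in> L_set"
    and e: "\<And>m. m \<in> S \<Longrightarrow> (\<Sum>i\<in>K. Poly_Mapping.lookup m i) \<le> e"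
    and rel: "mfps_const (int p) dvd (\<Sum>m\<in>S. c m * family_pow K g m)"
    and nz: "\<exists>m\<in>S. \<not> mfps_const (int p) dvd c m"
    and deg: "\<And>m. m \<in> S \<Longrightarrow> deg_le D (c m)"
  shows "\<exists>c'. mfps_const (int p) dvd (\<Sum>m\<in>S. c' m * family_pow K g m) \<and>
    (\<exists>m\<in>S. \<not> mfps_const (int p) dvd c' m) \<and> (\<forall>m\<in>S. deg_le e (c' m))"
proof -
  from L_set_common_lucas_at[where g = g, OF K L p]
  obtain k where k: "k \<ge> 1" "\<forall>i\<in>K. lucas_at (int p) (p ^ k) (g i)"
    by auto
  from k(2) obtain A where A: "\<And>i. i \<in> K \<Longrightarrow> deg_le (p ^ k - 1) (A i)"
    and cong: "\<And>i. i \<in> K \<Longrightarrow> mfps_const (int p) dvd g i - A i * mfps_subst_pow (p ^ k) (g i)"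
    unfolding lucas_at_def by metis
  \<comment> \<open>If \<open>A i\<close> vanished modulo \<open>p\<close>, so would
    \<open>g i\<close>, whose constant term is 1.\<close>
  have nA: "\<not> mfps_const (int p) dvd A i" if i: "i \<in> K" for i
  proof
    assume "mfps_const (int p) dvd A i"
    with cong[OF i] have "mfps_const (int p) dvd g i"
      by (metis diff_add_cancel dvd_add dvd_mult2)
    then have "int p dvd mfps_nth (g i) 0"
      by (simp add: mfps_const_dvd_iff)
    with L[OF i] p show False
      by (simp add: L_set_def)
  qed
  have "prime_or_zero (int p)"
    using p by (auto simp: prime_or_zero_def prime_dvd_mult_iff)
  moreover have "p ^ k > 1"
    using k(1) prime_gt_1_nat[OF p] by (intro one_less_power) auto
  ultimately show ?thesis
    using reduce_degree_relation[OF _ _ K cong nA A e rel nz deg] by blast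
qed

section \<open>Descent of linear dependence\<close>

text \<open>
  Fraction-free Gaussian elimination: with a pivot \<open>a = v j0 x0\<close>, the family \<open>a * v j x - v j x0 * v j0 x\<close>,
  \<open>j \<noteq> j0\<close>, is still dependent modulo every \<open>d\<close> that does not divide \<open>a\<close>. The case \<open>d = 0\<close> descends a dependence from the ambient domain to
  the subring \<open>R\<close>; for \<open>R = \<int>\<close> the \<open>d\<close> are infinitely many primes.
\<close>

lemma linear_dependence_descent:
  fixes v :: "'j \<Rightarrow> 'x \<Rightarrow> 'a::idom"
  assumes "finite J"
    and R: "1 \<in> R" "\<And>a b. a \<in> R \<Longrightarrow> b \<in> R \<Longrightarrow> a * b \<in> R" "\<And>a b. a \<in> R \<Longrightarrow> b \<in> R \<Longrightarrow> a - b \<in> R"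
    and "\<And>j x. j \<in> J \<Longrightarrow> v j x \<in> R"
    and "\<And>r. r \<in> R \<Longrightarrow> r \<noteq> 0 \<Longrightarrow> \<exists>d l. prime_or_zero d \<and> \<not> d dvd r \<and> (\<exists>j\<in>J. \<not> d dvd l j) \<and>
      (\<forall>x. d dvd (\<Sum>j\<in>J. l j * v j x))"
  shows "\<exists>l. (\<forall>j\<in>J. l j \<in> R) \<and> (\<exists>j\<in>J. l j \<noteq> 0) \<and> (\<forall>x. (\<Sum>j\<in>J. l j * v j x) = 0)"
  using assms(1,5,6)
proof (induction J arbitrary: v)
  case empty
  then show ?case
    using R(1) by fastforce
next
  case (insert j0 J)
  have R0: "0 \<in> R"
    using R(1,3) by force
  show ?case
  proof (cases "\<forall>x. v j0 x = 0")
    case True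
    then show ?thesis
      using R(1) R0 insert.hyps by (intro exI[of _ "\<lambda>j. if j = j0 then 1 else 0"])
        (auto intro!: sum.neutral)
  next
    case False
    then obtain x0 where x0: "v j0 x0 \<noteq> 0" by blast
    define a where "a = v j0 x0"
    have a: "a \<in> R" "a \<noteq> 0"
      using x0 insert.prems(1) by (auto simp: a_def)
    define w where "w j x = a * v j x - v j x0 * v j0 x" for j x
    have w: "w j x \<in> R" if "j \<in> J" for j x
      unfolding w_def using that a insert.prems(1) by (intro R) auto
    have "\<exists>d l. prime_or_zero d \<and> \<not> d dvd r \<and> (\<exists>j\<in>J. \<not> d dvd l j) \<and> (\<forall>x. d dvd (\<Sum>j\<in>J. l j * w j x))"
      if r: "r \<in> R" "r \<noteq> 0" for r
    proof -
      \<comment> \<open>Asking that \<open>d\<close> not divide \<open>r * a\<close> provides two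
        things at once: \<open>d\<close> avoids \<open>r\<close>, as the smaller family requires,
        and the pivot \<open>a\<close> is nonzero modulo \<open>d\<close>.\<close>
      have "r * a \<in> R" "r * a \<noteq> 0"
        using r a R by auto
      from insert.prems(2)[OF this] obtain d l where d: "prime_or_zero d" "\<not> d dvd r * a"
        and l: "\<exists>j\<in>insert j0 J. \<not> d dvd l j" and dvd: "\<And>x. d dvd (\<Sum>j\<in>insert j0 J. l j * v j x)"
        by blast
      have nd: "\<not> d dvd r" "\<not> d dvd a"
        using d(2) by (auto intro: dvd_mult dvd_mult2)
      have "d dvd (\<Sum>j\<in>J. l j * w j x)" for x
      proof -
        \<comment> \<open>The summands of \<open>j0\<close> on the right cancel because
          \<open>a = v j0 x0\<close>.\<close>
        have "(\<Sum>j\<in>J. l j * w j x) =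
            a * (\<Sum>j\<in>insert j0 J. l j * v j x) - v j0 x * (\<Sum>j\<in>insert j0 J. l j * v j x0)"
          using insert.hyps
          by (simp add: w_def a_def sum_distrib_left sum_subtractf algebra_simps)
        then show ?thesis
          by (simp only:) (intro dvd_diff dvd_mult dvd)
      qed
      moreover have "\<exists>j\<in>J. \<not> d dvd l j"
      proof (rule ccontr)
        assume neg: "\<not> (\<exists>j\<in>J. \<not> d dvd l j)"
        then have "d dvd (\<Sum>j\<in>J. l j * v j x0)"
          by (intro dvd_sum) auto
        moreover have "(\<Sum>j\<in>insert j0 J. l j * v j x0) = l j0 * a + (\<Sum>j\<in>J. l j * v j x0)"
          using insert.hyps by (simp add: a_def)
        ultimately have "d dvd l j0 * a"
          using dvd[of x0] by (simp add: dvd_add_left_iff)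
        with d(1) nd have "d dvd l j0"
          unfolding prime_or_zero_def by blast
        with l neg show False by auto
      qed
      ultimately show ?thesis
        using d nd by blast
    qed
    from insert.IH[OF w this] obtain l where l: "\<And>j. j \<in> J \<Longrightarrow> l j \<in> R" "\<exists>j\<in>J. l j \<noteq> 0"
      and zero: "\<And>x. (\<Sum>j\<in>J. l j * w j x) = 0"
      by auto
    \<comment> \<open>Back substitution: the coefficient of \<open>j0\<close> is determined by the
      relation at \<open>x0\<close>, and multiplying the others by \<open>a\<close> replaces a
      division, so everything stays in \<open>R\<close>.\<close>
    define l' where "l' j = (if j = j0 then - (\<Sum>j\<in>J. l j * v j x0) else a * l j)" for j
    have add: "s + t \<in> R" if "s \<in> R" "t \<in> R" for s t
      using R(3)[OF that(1) R(3)[OF R0 that(2)]] by simp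
    have "(\<Sum>j\<in>J'. l j * v j x0) \<in> R" if "J' \<subseteq> J" for J'
      using finite_subset[OF that insert.hyps(1)] that
      by (induction J') (use R0 add R(2) l(1) insert.prems(1) in auto)
    then have "l' j \<in> R" if "j \<in> insert j0 J" for j
      using that a(1) l(1) R(2,3) R0 unfolding l'_def by (metis diff_0 insertE order_refl)
    moreover have "\<exists>j\<in>insert j0 J. l' j \<noteq> 0"
      using l(2) a(2) insert.hyps(2) by (auto simp: l'_def)
    moreover have "(\<Sum>j\<in>insert j0 J. l' j * v j x) = 0" for x
    proof -
      have "(\<Sum>j\<in>J. l' j * v j x) = (\<Sum>j\<in>J. a * l j * v j x)"
        using insert.hyps(2) by (intro sum.cong) (auto simp: l'_def)
      then have "(\<Sum>j\<in>insert j0 J. l' j * v j x) = (\<Sum>j\<in>J. l j * w j x)"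
        using insert.hyps
        by (simp add: l'_def w_def sum_distrib_left sum_subtractf algebra_simps)
      with zero show ?thesis by simp
    qed
    ultimately show ?thesis by blast
  qed
qed

section \<open>Specialization of \<open>q\<close> modulo primes\<close>

abbreviation int_poly_eval :: "int poly \<Rightarrow> complex \<Rightarrow> complex" where
  "int_poly_eval P q \<equiv> poly (map_poly of_int P) q"

lemma ring_hom_fun_map_poly_of_int: "ring_hom_fun (map_poly of_int :: int poly \<Rightarrow> complex poly)"
proof -
  have "map_poly of_int (P + Q) = map_poly of_int P + (map_poly of_int Q :: complex poly)" for P Q
    by (rule poly_eqI) (simp add: coeff_map_poly)
  moreover have "map_poly of_int (P * Q) = map_poly of_int P * (map_poly of_int Q :: complex poly)"
    for P Q
    by (rule poly_eqI) (simp add: coeff_map_poly coeff_mult)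
  ultimately show ?thesis
    by (simp add: ring_hom_fun_def)
qed

lemma ring_hom_fun_int_poly_eval: "ring_hom_fun (\<lambda>P. int_poly_eval P q)"
  using ring_hom_fun_map_poly_of_int by (simp add: ring_hom_fun_def)

lemma ring_hom_fun_poly: "ring_hom_fun (\<lambda>P. poly P x)"
  by (simp add: ring_hom_fun_def)

lemma ring_hom_fun_of_int: "ring_hom_fun of_int"
  by (simp add: ring_hom_fun_def)

lemmas int_poly_eval_mult = ring_hom_fun_int_poly_eval[unfolded ring_hom_fun_def,
  THEN conjunct2, THEN conjunct2, rule_format]

lemmas int_poly_eval_add = ring_hom_fun_int_poly_eval[unfolded ring_hom_fun_def,
  THEN conjunct2, THEN conjunct1, rule_format]

lemma int_poly_eval_smult: "int_poly_eval (smult c P) q = of_int c * int_poly_eval P q"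
  using int_poly_eval_mult[of "[:c:]" P q] by (simp add: map_poly_pCons)

text \<open>Pseudo-division replaces division over the fraction field: the remainder is again in the
  ideal \<open>I\<close>, and its degree is below the minimum, so it is 0.\<close>

lemma ideal_min_degree_pseudo_divides:
  fixes M P :: "'a::idom poly"
  assumes "I P" "I M" "M \<noteq> 0"
    and closed: "\<And>A B. I A \<Longrightarrow> I B \<Longrightarrow> I (A + B)" "\<And>A B. I A \<Longrightarrow> I (B * A)"
    and min: "\<And>A. I A \<Longrightarrow> A \<noteq> 0 \<Longrightarrow> degree M \<le> degree A"
  shows "\<exists>k Q. smult (lead_coeff M ^ k) P = M * Q"
proof -
  obtain Q r where Qr: "pseudo_divmod P M = (Q, r)"
    by (cases "pseudo_divmod P M")
  define k where "k = Suc (degree P) - degree M"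
  have eq: "smult (lead_coeff M ^ k) P = M * Q + r" and deg: "r = 0 \<or> degree r < degree M"
    using pseudo_divmod[OF assms(3) Qr] by (simp_all add: k_def)
  have "r = [:lead_coeff M ^ k:] * P + (- Q) * M"
    using eq by simp
  then have "I r"
    using closed assms(1,2) by metis
  with min deg have "r = 0"
    by (metis leD)
  with eq show ?thesis
    by auto
qed

text \<open>
  Schur's argument: for \<open>c = M(0)\<close>, the values \<open>M(c K y) / c\<close> are congruent to 1 modulo \<open>K\<close>, so every prime
  divisor of such a value is coprime to \<open>K\<close>.
\<close>

lemma exists_prime_dvd_poly_value:
  fixes M :: "int poly"
  assumes "degree M > 0" "poly M 0 \<noteq> 0" "K \<noteq> 0"
  shows "\<exists>p t. prime p \<and> int p dvd poly M t \<and> \<not> int p dvd K"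
proof -
  obtain c M1 where M: "M = pCons c M1"
    by (cases M)
  have c: "c \<noteq> 0"
    using assms(2) by (simp add: M)
  \<comment> \<open>Only finitely many arguments give \<open>M\<close> one of the values
    \<open>c\<close>, \<open>- c\<close>; avoiding them makes the cofactor \<open>z\<close> below
    different from 1 and -1, so it has a prime divisor.\<close>
  have "infinite (range (\<lambda>y. c * K * y))"
    using c assms(3) by (intro notI) (drule finite_imageD, auto simp: inj_on_def)
  moreover have "M - [:c:] \<noteq> 0" "M + [:c:] \<noteq> 0"
    using assms(1) by (auto simp: M eq_neg_iff_add_eq_0 split: if_splits)
  then have "finite ({t. poly (M - [:c:]) t = 0} \<union> {t. poly (M + [:c:]) t = 0})"
    by (intro finite_UnI poly_roots_finite)
  ultimately have "\<not> range (\<lambda>y. c * K * y) \<subseteq> {t. poly (M - [:c:]) t = 0} \<union> {t. poly (M + [:c:]) t = 0}"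
    by (metis finite_subset)
  then obtain y where y: "poly (M - [:c:]) (c * K * y) \<noteq> 0" "poly (M + [:c:]) (c * K * y) \<noteq> 0"
    by auto
  define z where "z = 1 + K * y * poly M1 (c * K * y)"
  have z: "poly M (c * K * y) = c * z"
    by (simp add: M z_def algebra_simps)
  have "\<bar>z\<bar> \<noteq> 1"
    using y z by (auto simp: abs_if split: if_splits)
  then have "nat \<bar>z\<bar> \<noteq> 1"
    by linarith
  then obtain p where p: "prime p" "p dvd nat \<bar>z\<bar>"
    using prime_factor_nat by blast
  then have dvd: "int p dvd z"
    by (metis int_dvd_int_iff dvd_nat_abs_iff int_nat_eq abs_ge_zero dvd_abs_iff)
  have "\<not> int p dvd K"
  proof
    assume "int p dvd K"
    then have "int p dvd K * (y * poly M1 (c * K * y))"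
      by (rule dvd_mult2)
    with dvd have "int p dvd 1"
      unfolding z_def mult.assoc by (metis dvd_add_left_iff)
    with p(1) show False by simp
  qed
  with p(1) dvd z show ?thesis
    by (metis dvd_mult)
qed

text \<open>
  If \<open>q\<close> is algebraic with minimal integer polynomial \<open>M\<close>, a root \<open>t\<close> of \<open>M\<close> modulo \<open>p\<close> gives a homomorphism
  \<open>\<int>[q] \<rightarrow> \<int>/p\<close> as soon as \<open>p\<close> does not divide the leading coefficient of \<open>M\<close>, and a Bezout relation
  \<open>r = u \<beta> + v M\<close> with \<open>r \<noteq> 0\<close> shows that \<open>\<beta>\<close> is not killed unless \<open>p\<close> divides \<open>r\<close>.
\<close>

lemma exists_specialization:
  fixes \<beta> :: "int poly"
  assumes q: "q \<noteq> 0" and \<beta>: "int_poly_eval \<beta> q \<noteq> 0"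
  shows "\<exists>p t. prime p \<and> p > N \<and> (\<forall>P. int_poly_eval P q = 0 \<longrightarrow> int p dvd poly P t) \<and>
    \<not> int p dvd poly \<beta> t"
proof (cases "\<exists>P. P \<noteq> 0 \<and> int_poly_eval P q = 0")
  case False
  \<comment> \<open>In the transcendental case only the zero polynomial vanishes at
    \<open>q\<close>, so every \<open>t\<close> is compatible with the kernel. It suffices that
    \<open>\<beta>(t) \<noteq> 0\<close> and that \<open>p\<close> exceeds its absolute
    value.\<close>
  have "\<beta> \<noteq> 0"
    using \<beta> by auto
  then have "finite {t. poly \<beta> t = 0}"
    by (rule poly_roots_finite)
  then obtain t where t: "poly \<beta> t \<noteq> 0"
    using infinite_UNIV_int by (metis (mono_tags, lifting) UNIV_I finite_subset mem_Collect_eq subsetI)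
  obtain p where p: "prime p" "p > max N (nat \<bar>poly \<beta> t\<bar>)"
    using bigger_prime by blast
  have "\<not> int p dvd poly \<beta> t"
    using p(2) t zdvd_imp_le[of "int p" "\<bar>poly \<beta> t\<bar>"] by auto
  moreover have "int p dvd poly P t" if "int_poly_eval P q = 0" for P
    using False that by (cases "P = 0") auto
  ultimately show ?thesis
    using p by auto
next
  case True
  define Ker where "Ker P \<longleftrightarrow> int_poly_eval P q = 0" for P
  obtain M where M: "M \<noteq> 0" "Ker M" and M_min: "\<And>P. Ker P \<Longrightarrow> P \<noteq> 0 \<Longrightarrow> degree M \<le> degree P"
  proof -
    from True obtain P where "P \<noteq> 0 \<and> Ker P"
      unfolding Ker_def by blast
    from ex_has_least_nat[of "\<lambda>P. P \<noteq> 0 \<and> Ker P", OF this, of degree] show ?thesis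
      using that by blast
  qed
  have deg_M: "degree M > 0"
  proof (rule ccontr)
    assume "\<not> degree M > 0"
    then obtain c where "M = [:c:]"
      by (metis degree_eq_zeroE gr0I)
    then show False
      using M by (simp add: Ker_def map_poly_pCons)
  qed
  \<comment> \<open>Here \<open>q \<noteq> 0\<close> enters: a factor \<open>x\<close> of
    \<open>M\<close> could be cancelled, against the minimality of the degree. Schur's argument
    needs this nonzero constant term.\<close>
  have M0: "poly M 0 \<noteq> 0"
  proof
    assume "poly M 0 = 0"
    then obtain M1 where M1: "M = [:0, 1:] * M1"
      using dvd_iff_poly_eq_0[of 0 M] by (auto elim: dvdE)
    then have "M1 \<noteq> 0" "Ker M1"
      using M q by (auto simp: Ker_def int_poly_eval_mult map_poly_pCons simp del: mult_pCons_left)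
    with M_min[of M1] M1 show False
      by (simp add: degree_mult_eq)
  qed
  have Ker_dvd: "\<exists>k Q. smult (lead_coeff M ^ k) P = M * Q" if "Ker P" for P
    using that M M_min
    by (intro ideal_min_degree_pseudo_divides[of Ker])
       (auto simp: Ker_def int_poly_eval_mult int_poly_eval_add)
  \<comment> \<open>An element of least degree in the ideal generated by \<open>\<beta>\<close> and
    \<open>M\<close> acts as their greatest common divisor over the rationals; it will be the
    constant \<open>r\<close> of the Bezout relation.\<close>
  define I where "I P \<longleftrightarrow> (\<exists>u v. P = u * \<beta> + v * M)" for P
  have I: "I \<beta>" "I M"
    unfolding I_def by (metis add_0_right mult_1 mult_zero_left) (metis add_0 mult_1 mult_zero_left)
  obtain d where d: "d \<noteq> 0" "I d" and d_min: "\<And>P. I P \<Longrightarrow> P \<noteq> 0 \<Longrightarrow> degree d \<le> degree P"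
    using I(2) M(1) ex_has_least_nat[of "\<lambda>P. P \<noteq> 0 \<and> I P" M degree] by auto
  have I_add: "I (A + B)" if "I A" "I B" for A B
  proof -
    from that obtain u v u' v' where "A = u * \<beta> + v * M" "B = u' * \<beta> + v' * M"
      unfolding I_def by blast
    then have "A + B = (u + u') * \<beta> + (v + v') * M"
      by (simp add: algebra_simps)
    then show ?thesis unfolding I_def by blast
  qed
  have I_mult: "I (B * A)" if "I A" for A B
  proof -
    from that obtain u v where "A = u * \<beta> + v * M"
      unfolding I_def by blast
    then have "B * A = (B * u) * \<beta> + (B * v) * M"
      by (simp add: algebra_simps)
    then show ?thesis unfolding I_def by blast
  qed
  have I_dvd: "\<exists>k Q. smult (lead_coeff d ^ k) P = d * Q" if "I P" for P
    using that d d_min I_add I_mult by (intro ideal_min_degree_pseudo_divides[of I]) auto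
  \<comment> \<open>Up to integer factors \<open>d\<close> divides both \<open>\<beta>\<close> and
    \<open>M\<close>. The former gives \<open>d(q) \<noteq> 0\<close>, so the cofactor of
    \<open>d\<close> in \<open>M\<close> vanishes at \<open>q\<close> and has at least the degree of
    \<open>M\<close>.\<close>
  have "degree d = 0"
  proof -
    obtain k Q where kQ: "smult (lead_coeff d ^ k) \<beta> = d * Q"
      using I_dvd[OF I(1)] by blast
    then have "of_int (lead_coeff d ^ k) * int_poly_eval \<beta> q = int_poly_eval d q * int_poly_eval Q q"
      by (metis int_poly_eval_mult int_poly_eval_smult)
    then have "int_poly_eval d q \<noteq> 0"
      using \<beta> d(1) by auto
    moreover obtain k Q where kQ: "smult (lead_coeff d ^ k) M = d * Q"
      using I_dvd[OF I(2)] by blast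
    then have "of_int (lead_coeff d ^ k) * int_poly_eval M q = int_poly_eval d q * int_poly_eval Q q"
      by (metis int_poly_eval_mult int_poly_eval_smult)
    ultimately have "Ker Q"
      using M(2) by (simp add: Ker_def)
    moreover have "Q \<noteq> 0"
      using kQ M(1) d(1) by auto
    ultimately have "degree M \<le> degree Q"
      using M_min by blast
    moreover have "degree M = degree d + degree Q"
      using arg_cong[OF kQ, of degree] d(1) \<open>Q \<noteq> 0\<close> by (simp add: degree_mult_eq)
    ultimately show ?thesis by simp
  qed
  then obtain r where r: "d = [:r:]"
    by (metis degree_eq_zeroE)
  with d obtain u v where uv: "[:r:] = u * \<beta> + v * M" and r0: "r \<noteq> 0"
    unfolding I_def by auto
  \<comment> \<open>Avoiding \<open>fact N\<close> makes \<open>p\<close> larger than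
    \<open>N\<close>, avoiding \<open>r\<close> keeps \<open>\<beta>(t)\<close> nonzero modulo
    \<open>p\<close>, and avoiding the leading coefficient allows it to be cancelled after
    pseudo-division by \<open>M\<close>.\<close>
  have "fact N * r * lead_coeff M \<noteq> 0"
    using M(1) r0 by simp
  from exists_prime_dvd_poly_value[OF deg_M M0 this]
  obtain p t where p: "prime p" "int p dvd poly M t" "\<not> int p dvd fact N * r * lead_coeff M"
    by blast
  then have np: "\<not> int p dvd fact N" "\<not> int p dvd r" "\<not> int p dvd lead_coeff M"
    by (auto intro: dvd_mult dvd_mult2)
  have "p > N"
  proof (rule ccontr)
    assume "\<not> p > N"
    then have "p dvd fact N"
      using prime_ge_1_nat[OF p(1)] by (intro dvd_fact) auto
    with np(1) show False
      by (metis int_dvd_int_iff of_nat_fact)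
  qed
  moreover have "int p dvd poly P t" if P: "int_poly_eval P q = 0" for P
  proof -
    obtain k Q where "smult (lead_coeff M ^ k) P = M * Q"
      using Ker_dvd P unfolding Ker_def by blast
    from arg_cong[OF this, of "\<lambda>A. poly A t"] have "lead_coeff M ^ k * poly P t = poly M t * poly Q t"
      by simp
    with p(2) have "int p dvd lead_coeff M ^ k * poly P t"
      by simp
    moreover have prime: "prime (int p)"
      using p(1) by simp
    ultimately have "int p dvd lead_coeff M ^ k \<or> int p dvd poly P t"
      by (blast dest: prime_dvd_multD)
    with np(3) prime_dvd_power[OF prime] show ?thesis
      by blast
  qed
  moreover have "\<not> int p dvd poly \<beta> t"
  proof
    assume "int p dvd poly \<beta> t"
    then have "int p dvd poly u t * poly \<beta> t + poly v t * poly M t"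
      using p(2) by (intro dvd_add dvd_mult) auto
    moreover have "r = poly u t * poly \<beta> t + poly v t * poly M t"
      using arg_cong[OF uv, of "\<lambda>A. poly A t"] by simp
    ultimately show False
      using np(2) by simp
  qed
  ultimately show ?thesis
    using p(1) by blast
qed

section \<open>Cyclotomic polynomials\<close>

lemma degree_prod_linear: "degree (\<Prod>k\<in>A. [:- (f k :: 'a::idom), 1:]) = card A"
  by (cases "finite A") (simp_all add: degree_prod_eq_sum_degree)

lemma lead_coeff_prod_linear: "lead_coeff (\<Prod>k\<in>A. [:- (f k :: 'a::idom), 1:]) = 1"
  by (simp add: lead_coeff_prod)

text \<open>Both polynomials have degree at most \<open>n\<close> and coefficient 1 at
  \<open>n\<close>, and they agree at the \<open>n\<close> roots of unity.\<close>

lemma prod_roots_unity: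
  assumes "n > 0"
  shows "(\<Prod>k\<in>{1..n}. [:- cis (2 * pi * real k / real n), 1:]) = monom 1 n - 1"
    (is "?P = _")
proof (rule poly_eqI_degree_lead_coeff)
  have deg: "degree ?P = n"
    by (simp add: degree_prod_linear del: mult_pCons_left)
  then show "degree ?P \<le> n"
    by simp
  have "coeff ?P n = 1"
    using lead_coeff_prod_linear[of "\<lambda>k. cis (2 * pi * real k / real n)" "{1..n}"] deg by simp
  then show "coeff ?P n = coeff (monom 1 n - 1) n"
    using assms by simp
  show "degree (monom 1 n - 1 :: complex poly) \<le> n"
    by (intro degree_diff_le) (simp_all add: degree_monom_le)
  show "n \<le> card {z :: complex. z ^ n = 1}"
    using card_roots_unity_eq[OF assms] by simp
  fix z :: complex
  assume "z \<in> {z. z ^ n = 1}"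
  then obtain k where k: "k < n" "z = cis (2 * pi * real k / real n)"
    using bij_betw_roots_unity[OF assms] by (auto simp: bij_betw_def)
  \<comment> \<open>The library numbers the roots from 0 to \<open>n - 1\<close>, the product from 1
    to \<open>n\<close>; the index 0 becomes \<open>n\<close>.\<close>
  define k' where "k' = (if k = 0 then n else k)"
  have "k' \<in> {1..n}" "z = cis (2 * pi * real k' / real n)"
    using k by (auto simp: k'_def)
  then have "poly ?P z = 0"
    by (force simp: poly_prod)
  then show "poly ?P z = poly (monom 1 n - 1) z"
    using \<open>z \<in> _\<close> by (simp add: poly_monom)
qed

text \<open>The fractions \<open>k / n\<close> with \<open>1 \<le> k \<le> n\<close> are sorted by
  their denominators \<open>d\<close> in lowest terms.\<close>

lemma prod_cyclotomic:
  assumes n: "n > 0"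
  shows "(\<Prod>d | d dvd n. cyclotomic d) = monom 1 n - 1"
proof -
  let ?S = "Sigma {d. d dvd n} (\<lambda>d. {k \<in> {1..d}. coprime k d})"
  have "(\<Prod>d | d dvd n. cyclotomic d) =
      (\<Prod>(d, k)\<in>?S. [:- cis (2 * pi * real k / real d), 1:])"
    unfolding cyclotomic_def using n by (intro prod.Sigma) auto
  also have "\<dots> = (\<Prod>k\<in>{1..n}. [:- cis (2 * pi * real k / real n), 1:])"
  proof (rule prod.reindex_bij_witness[where j = "\<lambda>(d, k). k * (n div d)"
        and i = "\<lambda>k. (n div gcd k n, k div gcd k n)"])
    fix k
    assume k: "k \<in> {1..n}"
    then have g: "gcd k n > 0"
      by simp
    have "n div (n div gcd k n) = gcd k n"
      using n by (metis dvd_div_mult_self div_by_0 gcd_dvd2 mult_eq_0_iff nonzero_mult_div_cancel_left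
          not_gr_zero)
    then show "(case (n div gcd k n, k div gcd k n) of (d, k) \<Rightarrow> k * (n div d)) = k"
      by simp
    have "n div gcd k n dvd n"
      by (metis dvd_triv_left dvd_div_mult_self gcd_dvd2)
    moreover have "k div gcd k n \<ge> 1"
      using k g by (simp add: Suc_le_eq div_greater_zero_iff)
    ultimately show "(n div gcd k n, k div gcd k n) \<in> ?S"
      using k g by (auto simp: div_le_mono div_gcd_coprime dvd_div_eq_mult)
  next
    fix x
    assume "x \<in> ?S"
    then obtain d k where x: "x = (d, k)" and d: "d dvd n" and k: "k \<ge> 1" "k \<le> d" "coprime k d"
      by auto
    from d obtain e where e: "n = d * e" ..
    have pos: "d > 0" "e > 0"
      using n e by auto
    have "gcd (e * k) (e * d) = e"
      using k(3) by (simp add: gcd_mult_left)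
    then have gcd: "gcd (k * e) n = e"
      by (simp only: e mult.commute[of k] mult.commute[of d])
    show "(case x of (d, k) \<Rightarrow> k * (n div d)) \<in> {1..n}"
      using k pos by (simp add: x e)
    show "(n div gcd (case x of (d, k) \<Rightarrow> k * (n div d)) n,
        (case x of (d, k) \<Rightarrow> k * (n div d)) div gcd (case x of (d, k) \<Rightarrow> k * (n div d)) n) = x"
      using pos gcd by (simp add: x e)
    show "[:- cis (2 * pi * real (case x of (d, k) \<Rightarrow> k * (n div d)) / real n), 1:] =
        (case x of (d, k) \<Rightarrow> [:- cis (2 * pi * real k / real d), 1:])"
      using pos by (simp add: x e mult.assoc)
  qed
  also have "\<dots> = monom 1 n - 1"
    by (rule prod_roots_unity[OF n])
  finally show ?thesis .
qed

lemma lead_coeff_cyclotomic: "lead_coeff (cyclotomic d) = 1"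
  unfolding cyclotomic_def by (rule lead_coeff_prod_linear)

text \<open>By induction the product \<open>\<Psi>\<close> over the proper divisors is integral. As
  it is also monic, \<open>x^n - 1\<close> can be divided by it over the integers, and the quotient
  is the polynomial sought.\<close>

lemma cyclotomic_integral: "n > 0 \<Longrightarrow> \<exists>P :: int poly. map_poly of_int P = cyclotomic n"
proof (induction n rule: less_induct)
  case (less n)
  define D where "D = {d. d dvd n} - {n}"
  have "\<exists>P :: int poly. map_poly of_int P = cyclotomic d" if "d \<in> D" for d
  proof (rule less.IH)
    have d: "d dvd n" "d \<noteq> n"
      using that by (auto simp: D_def)
    show "d > 0"
      by (rule dvd_pos_nat[OF less.prems d(1)])
    show "d < n"
      using dvd_imp_le[OF d(1) less.prems] d(2) by simp
  qed
  then have "\<forall>d\<in>D. \<exists>P :: int poly. map_poly of_int P = cyclotomic d"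
    by blast
  from bchoice[OF this] obtain \<Phi> :: "nat \<Rightarrow> int poly"
    where \<Phi>: "\<And>d. d \<in> D \<Longrightarrow> map_poly of_int (\<Phi> d) = cyclotomic d"
    by blast
  let ?h = "map_poly of_int :: int poly \<Rightarrow> complex poly"
  define \<Psi> where "\<Psi> = (\<Prod>d\<in>D. \<Phi> d)"
  have hom: "?h (x * y) = ?h x * ?h y" "?h (x + y) = ?h x + ?h y" for x y
    using ring_hom_fun_map_poly_of_int by (simp_all add: ring_hom_fun_def)
  have \<Psi>: "?h \<Psi> = (\<Prod>d\<in>D. cyclotomic d)"
    using \<Phi> by (simp add: \<Psi>_def ring_hom_fun_prod[OF ring_hom_fun_map_poly_of_int])
  have deg: "degree (?h P) = degree P" for P
    by (rule degree_map_poly) simp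
  have "of_int (lead_coeff \<Psi>) = lead_coeff (?h \<Psi>)"
    by (simp add: deg coeff_map_poly)
  also have "\<dots> = 1"
    by (simp add: \<Psi> lead_coeff_prod lead_coeff_cyclotomic)
  finally have lc: "lead_coeff \<Psi> = 1"
    by simp
  then have "\<Psi> \<noteq> 0"
    by auto
  obtain Q r where Qr: "pseudo_divmod (monom 1 n - 1) \<Psi> = (Q, r)"
    by (cases "pseudo_divmod (monom 1 n - 1) \<Psi>")
  have eq: "monom 1 n - 1 = \<Psi> * Q + r" and r: "r = 0 \<or> degree r < degree \<Psi>"
    using pseudo_divmod[OF \<open>\<Psi> \<noteq> 0\<close> Qr] lc by simp_all
  have "?h (monom 1 n - 1) = monom 1 n - 1"
    by (rule poly_eqI) (simp add: coeff_map_poly)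
  also have "\<dots> = (\<Prod>d | d dvd n. cyclotomic d)"
    by (rule prod_cyclotomic[OF less.prems, symmetric])
  also have "\<dots> = cyclotomic n * ?h \<Psi>"
    unfolding \<Psi> D_def using less.prems by (intro prod.remove) auto
  finally have hr: "?h \<Psi> * (cyclotomic n - ?h Q) = ?h r"
    unfolding eq hom by (simp add: algebra_simps)
  \<comment> \<open>The remainder is a multiple of \<open>\<Psi>\<close> over the complex numbers
    but has smaller degree, so it vanishes.\<close>
  have "?h \<Psi> * (cyclotomic n - ?h Q) = 0"
  proof (rule ccontr)
    assume nz: "?h \<Psi> * (cyclotomic n - ?h Q) \<noteq> 0"
    then have "degree \<Psi> \<le> degree (?h \<Psi> * (cyclotomic n - ?h Q))"
      by (subst degree_mult_eq) (auto simp: deg)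
    moreover have "r \<noteq> 0"
      using nz by (auto simp: hr)
    ultimately show False
      using r by (simp add: hr deg)
  qed
  then show ?case
    using \<open>\<Psi> \<noteq> 0\<close> by (intro exI[of _ Q]) (auto simp: map_poly_eq_0_iff)
qed

lemma map_poly_of_int_inject:
  assumes "map_poly of_int P = (map_poly of_int Q :: complex poly)"
  shows "P = Q"
proof (rule poly_eqI)
  fix i
  show "coeff P i = coeff Q i"
    using arg_cong[OF assms, of "\<lambda>A. coeff A i"] by (simp add: coeff_map_poly)
qed

section \<open>Prime divisors of cyclotomic values\<close>

lemma exists_power_minus_one_dvd:
  assumes p: "prime p" and t: "\<not> int p dvd t"
  shows "\<exists>n>0. int p dvd t ^ n - 1"
proof -
  have "finite (range (\<lambda>i. t ^ i mod int p))"
    by (rule finite_subset[of _ "{0..<int p}"]) (use prime_gt_0_nat[OF p] in auto)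
  then have "\<not> inj (\<lambda>i :: nat. t ^ i mod int p)"
    using finite_imageD infinite_UNIV_nat by blast
  then obtain i j :: nat where ij: "i < j" "t ^ i mod int p = t ^ j mod int p"
    unfolding inj_def by (metis linorder_neqE_nat)
  from ij(2)[symmetric] have "int p dvd t ^ j - t ^ i"
    by (simp add: mod_eq_dvd_iff)
  moreover have "t ^ j - t ^ i = t ^ i * (t ^ (j - i) - 1)"
    using ij(1) by (simp add: algebra_simps flip: power_add)
  moreover have prime: "prime (int p)"
    using p by simp
  ultimately have "int p dvd t ^ i \<or> int p dvd t ^ (j - i) - 1"
    by (metis prime_dvd_multD)
  then have "int p dvd t ^ (j - i) - 1"
    using t prime_dvd_power[OF prime] by blast
  with ij(1) show ?thesis
    by (intro exI[of _ "j - i"]) auto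
qed

text \<open>Since \<open>t\<close> has finite order modulo \<open>p\<close>, some
  \<open>t^n - 1\<close> is divisible by \<open>p\<close>, and hence so is one of its cyclotomic
  factors at \<open>t\<close>.\<close>

lemma exists_cyclotomic_dvd:
  assumes p: "prime p" and t: "\<not> int p dvd t"
  shows "\<exists>b\<ge>1. \<exists>\<Phi> :: int poly. map_poly of_int \<Phi> = cyclotomic b \<and> int p dvd poly \<Phi> t"
proof -
  obtain n where n: "n > 0" "int p dvd t ^ n - 1"
    using exists_power_minus_one_dvd[OF assms] by blast
  have "\<exists>P :: int poly. map_poly of_int P = cyclotomic d" if "d dvd n" for d
    using that n(1) by (intro cyclotomic_integral) (auto intro: dvd_pos_nat)
  then have "\<forall>d\<in>{d. d dvd n}. \<exists>P :: int poly. map_poly of_int P = cyclotomic d"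
    by blast
  from bchoice[OF this] obtain \<Phi> :: "nat \<Rightarrow> int poly"
    where \<Phi>: "\<And>d. d dvd n \<Longrightarrow> map_poly of_int (\<Phi> d) = cyclotomic d"
    by blast
  have "map_poly of_int (\<Prod>d | d dvd n. \<Phi> d) = (monom 1 n - 1 :: complex poly)"
    using \<Phi> by (simp add: ring_hom_fun_prod[OF ring_hom_fun_map_poly_of_int] prod_cyclotomic[OF n(1), symmetric])
  also have "\<dots> = map_poly of_int (monom 1 n - 1 :: int poly)"
    by (rule poly_eqI) (simp add: coeff_map_poly)
  finally have "(\<Prod>d | d dvd n. \<Phi> d) = monom 1 n - 1"
    by (rule map_poly_of_int_inject)
  then have "(\<Prod>d | d dvd n. poly (\<Phi> d) t) = t ^ n - 1"
    by (metis poly_prod poly_diff poly_monom poly_1 mult_1)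
  then have "int p dvd (\<Prod>d | d dvd n. poly (\<Phi> d) t)"
    using n(2) by simp
  then obtain d where "d dvd n" "int p dvd poly (\<Phi> d) t"
    using p n(1) prime_dvd_prod_iff[of "{d. d dvd n}" "int p"] by auto
  with \<Phi> n(1) show ?thesis
    by (intro exI[of _ d]) (auto simp: Suc_le_eq intro: dvd_pos_nat)
qed

section \<open>Relations with polynomial coefficients\<close>

lemma mfps_of_mpoly_eq_0_iff: "mfps_of_mpoly A = 0 \<longleftrightarrow> A = 0"
  by (auto simp: mfps_eq_iff poly_mapping_eq_iff fun_eq_iff)

lemma to_fract_prod: "to_fract (prod f A) = (\<Prod>x\<in>A. to_fract (f x))"
  by (induction A rule: infinite_finite_induct) simp_all

lemma to_fract_power: "to_fract (x ^ k) = to_fract x ^ k"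
  by (induction k) simp_all

lemma to_fract_family_pow:
  assumes "finite K" "Poly_Mapping.keys m \<subseteq> K"
  shows "to_fract (family_pow K F m) =
    (\<Prod>i\<in>Poly_Mapping.keys m. to_fract (F i) ^ Poly_Mapping.lookup m i)"
proof -
  have "(\<Prod>i\<in>Poly_Mapping.keys m. to_fract (F i) ^ Poly_Mapping.lookup m i) =
      (\<Prod>i\<in>K. to_fract (F i) ^ Poly_Mapping.lookup m i)"
    using assms by (intro prod.mono_neutral_left) (auto simp: in_keys_iff)
  then show ?thesis
    by (simp add: family_pow_def to_fract_prod to_fract_power)
qed

text \<open>Clearing denominators reduces independence over rational functions to relations between
  power series with polynomial coefficients.\<close>

lemma mfps_alg_independentI:
  fixes F :: "'i \<Rightarrow> ('v::finite, complex) mfps"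
  assumes K: "finite K"
    and indep: "\<And>S c D. finite S \<Longrightarrow> (\<And>m. m \<in> S \<Longrightarrow> Poly_Mapping.keys m \<subseteq> K) \<Longrightarrow>
      (\<And>m. m \<in> S \<Longrightarrow> deg_le D (c m)) \<Longrightarrow> (\<Sum>m\<in>S. c m * family_pow K F m) = 0 \<Longrightarrow>
      \<forall>m\<in>S. c m = 0"
  shows "mfps_alg_independent K F"
  unfolding mfps_alg_independent_def alg_independent_over_def
proof (intro allI impI notI)
  fix P :: "('i, ('v, complex) mfps fract) mpoly"
  assume P: "P \<noteq> 0" and rat: "\<forall>m. Poly_Mapping.lookup P m \<in> rational_functions"
    and keys: "\<forall>m\<in>Poly_Mapping.keys P. Poly_Mapping.keys m \<subseteq> K"
    and eval: "mpoly_eval (\<lambda>i. to_fract (F i)) P = 0"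
  define S where "S = Poly_Mapping.keys P"
  have S: "finite S" "S \<noteq> {}"
    using P by (simp_all add: S_def)
  have "\<forall>m. \<exists>A B. Poly_Mapping.lookup P m = Fract (mfps_of_mpoly A) (mfps_of_mpoly B) \<and> B \<noteq> 0"
    using rat unfolding rational_functions_def by blast
  then obtain A B where AB: "\<And>m. Poly_Mapping.lookup P m = Fract (mfps_of_mpoly (A m)) (mfps_of_mpoly (B m))"
    and B: "\<And>m. B m \<noteq> 0"
    by metis
  \<comment> \<open>This is the coefficient at \<open>m\<close> times the common denominator
    \<open>b\<close>, written without division.\<close>
  define c where "c m = mfps_of_mpoly (A m) * (\<Prod>k\<in>S - {m}. mfps_of_mpoly (B k))" for m
  define b where "b = (\<Prod>k\<in>S. mfps_of_mpoly (B k))"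
  have c: "to_fract (c m) = to_fract b * Poly_Mapping.lookup P m" if "m \<in> S" for m
  proof -
    have "b = mfps_of_mpoly (B m) * (\<Prod>k\<in>S - {m}. mfps_of_mpoly (B k))"
      unfolding b_def using S that by (intro prod.remove)
    then show ?thesis
      using B[of m] by (simp add: c_def AB Fract_conv_to_fract mfps_of_mpoly_eq_0_iff)
  qed
  have "\<exists>E. deg_le E (c m)" for m
  proof -
    obtain D' where "deg_le D' (mfps_of_mpoly (A m))"
      using deg_le_mpoly_ex by blast
    moreover have "\<forall>k. \<exists>D. deg_le D (mfps_of_mpoly (B k))"
      using deg_le_mpoly_ex by blast
    from choice[OF this] obtain D where "\<And>k. deg_le (D k) (mfps_of_mpoly (B k))"
      by blast
    ultimately show ?thesis
      unfolding c_def by (meson deg_le_mult deg_le_prod)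
  qed
  then have "\<forall>m. \<exists>E. deg_le E (c m)"
    by blast
  from choice[OF this] obtain E where E: "\<And>m. deg_le (E m) (c m)"
    by blast
  have "deg_le (sum E S) (c m)" if "m \<in> S" for m
    by (rule deg_le_mono[OF E]) (use that S in \<open>auto intro: member_le_sum\<close>)
  moreover have "(\<Sum>m\<in>S. c m * family_pow K F m) = 0"
  proof -
    have "to_fract (c m * family_pow K F m) = to_fract b * (Poly_Mapping.lookup P m *
        (\<Prod>i\<in>Poly_Mapping.keys m. to_fract (F i) ^ Poly_Mapping.lookup m i))" if "m \<in> S" for m
      using that keys c[OF that] by (simp add: S_def to_fract_family_pow[OF K])
    then have "to_fract (\<Sum>m\<in>S. c m * family_pow K F m) =
        to_fract b * mpoly_eval (\<lambda>i. to_fract (F i)) P"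
      by (simp add: mpoly_eval_def sum_distrib_left flip: S_def del: to_fract_mult)
    then have "to_fract (\<Sum>m\<in>S. c m * family_pow K F m) = 0"
      by (simp only: eval mult_zero_right)
    then show ?thesis
      by (simp only: to_fract_eq_0_iff)
  qed
  ultimately have zero: "\<forall>m\<in>S. c m = 0"
    using indep[of S "sum E S" c] S(1) keys by (simp add: S_def)
  obtain m where m: "m \<in> S"
    using S(2) by blast
  have "to_fract b \<noteq> 0"
    using S(1) B by (simp add: b_def mfps_of_mpoly_eq_0_iff)
  then have "Poly_Mapping.lookup P m = 0"
    using zero c[OF m] m by simp
  with m show False
    by (simp add: S_def in_keys_iff)
qed

text \<open>In the other direction, polynomial coefficients are rational functions with denominator
  1.\<close>

lemma mfps_alg_independentD:
  fixes F :: "'i \<Rightarrow> ('v::finite, complex) mfps"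
  assumes indep: "mfps_alg_independent K F" and K: "finite K" and S: "finite S"
    and keys: "\<And>m. m \<in> S \<Longrightarrow> Poly_Mapping.keys m \<subseteq> K"
    and deg: "\<And>m. m \<in> S \<Longrightarrow> deg_le D (c m)"
    and zero: "(\<Sum>m\<in>S. c m * family_pow K F m) = 0"
    and m: "m \<in> S"
  shows "c m = 0"
proof (rule ccontr)
  assume nz: "c m \<noteq> 0"
  define P where "P = Abs_poly_mapping (\<lambda>m. if m \<in> S then to_fract (c m) else 0)"
  have P: "Poly_Mapping.lookup P k = (if k \<in> S then to_fract (c k) else 0)" for k
    unfolding P_def by (subst lookup_Abs_poly_mapping) (auto intro: finite_subset[OF _ S])
  have "P \<noteq> 0"
    using P[of m] m nz by auto
  moreover have "Poly_Mapping.lookup P k \<in> rational_functions" for k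
  proof -
    have "\<exists>A :: ('v, complex) mpoly. (if k \<in> S then c k else 0) = mfps_of_mpoly A"
      using deg_le_imp_mpoly[OF deg[of k]] mfps_of_mpoly_eq_0_iff[of 0] by auto
    then obtain A :: "('v, complex) mpoly" where A: "(if k \<in> S then c k else 0) = mfps_of_mpoly A"
      by blast
    have "mfps_of_mpoly (1 :: ('v, complex) mpoly) = 1"
      by (rule mfps_eqI) (simp add: mfps_nth_one lookup_one when_def)
    then have "Poly_Mapping.lookup P k = Fract (mfps_of_mpoly A) (mfps_of_mpoly (1 :: ('v, complex) mpoly))"
      using arg_cong[OF A, of to_fract] by (simp add: P Fract_conv_to_fract split: if_splits)
    then show ?thesis
      unfolding rational_functions_def mem_Collect_eq by (intro exI[of _ A] exI[of _ 1] conjI) simp_all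
  qed
  moreover have keys_P: "Poly_Mapping.keys P \<subseteq> S"
    by (auto simp: in_keys_iff P split: if_splits)
  moreover have "mpoly_eval (\<lambda>i. to_fract (F i)) P = 0"
  proof -
    have "mpoly_eval (\<lambda>i. to_fract (F i)) P = (\<Sum>m\<in>S. Poly_Mapping.lookup P m *
        (\<Prod>i\<in>Poly_Mapping.keys m. to_fract (F i) ^ Poly_Mapping.lookup m i))"
      unfolding mpoly_eval_def using keys_P S
      by (intro sum.mono_neutral_left) (auto simp: in_keys_iff)
    also have "\<dots> = to_fract (\<Sum>m\<in>S. c m * family_pow K F m)"
      using keys by (simp add: P to_fract_family_pow[OF K])
    finally show ?thesis
      by (simp add: zero)
  qed
  ultimately show False
    using indep keys unfolding mfps_alg_independent_def alg_independent_over_def by blast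
qed

section \<open>Transfer of relations\<close>

lemma int_adjoin_eq_range: "int_adjoin q = range (\<lambda>P. int_poly_eval P q)"
  by (auto simp: int_adjoin_def)

lemma int_adjoin_closed:
  shows "1 \<in> int_adjoin q"
    and "a \<in> int_adjoin q \<Longrightarrow> b \<in> int_adjoin q \<Longrightarrow> a * b \<in> int_adjoin q"
    and "a \<in> int_adjoin q \<Longrightarrow> b \<in> int_adjoin q \<Longrightarrow> a - b \<in> int_adjoin q"
proof -
  have "int_poly_eval 1 q = 1"
    by simp
  then show "1 \<in> int_adjoin q"
    unfolding int_adjoin_eq_range by (metis rangeI)
  show "a * b \<in> int_adjoin q" if "a \<in> int_adjoin q" "b \<in> int_adjoin q"
    using that unfolding int_adjoin_eq_range by (auto simp flip: int_poly_eval_mult)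
  show "a - b \<in> int_adjoin q" if "a \<in> int_adjoin q" "b \<in> int_adjoin q"
    using that unfolding int_adjoin_eq_range
    by (auto simp flip: ring_hom_fun_diff[OF ring_hom_fun_int_poly_eval])
qed

section \<open>Lifting to integer polynomials and specializing\<close>

text \<open>Representatives are chosen coefficient by coefficient, with 0 lifted to 0, so that
  degree bounds survive the lift.\<close>

lemma mfps_lift_int_adjoin:
  fixes f :: "('v, complex) mfps"
  assumes "\<And>m. mfps_nth f m \<in> int_adjoin q"
  shows "\<exists>F. f = mfps_map (\<lambda>P. int_poly_eval P q) F \<and> (\<forall>m. mfps_nth f m = 0 \<longrightarrow> mfps_nth F m = 0)"
proof -
  have "\<exists>P. mfps_nth f m = int_poly_eval P q \<and> (mfps_nth f m = 0 \<longrightarrow> P = 0)" for m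
  proof (cases "mfps_nth f m = 0")
    case False
    with assms[of m] show ?thesis
      by (auto simp: int_adjoin_eq_range)
  qed (auto intro: exI[of _ 0])
  then have "\<forall>m. \<exists>P. mfps_nth f m = int_poly_eval P q \<and> (mfps_nth f m = 0 \<longrightarrow> P = 0)"
    by blast
  from choice[OF this] obtain F
    where "\<And>m. mfps_nth f m = int_poly_eval (F m) q \<and> (mfps_nth f m = 0 \<longrightarrow> F m = 0)"
    by blast
  then show ?thesis
    by (intro exI[of _ "Abs_mfps F"]) (auto simp: mfps_eq_iff)
qed

lemma mfps_map_relation:
  assumes "ring_hom_fun h"
  shows "mfps_map h (\<Sum>m\<in>S. c m * family_pow K F m) =
    (\<Sum>m\<in>S. mfps_map h (c m) * family_pow K (\<lambda>i. mfps_map h (F i)) m)"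
  by (simp add: ring_hom_fun_sum[OF ring_hom_fun_mfps_map[OF assms]]
      family_pow_hom[OF ring_hom_fun_mfps_map[OF assms]] mfps_map_mult[OF assms])

lemma mfps_map_monom: "ring_hom_fun h \<Longrightarrow> mfps_map h (mfps_monom s) = mfps_monom s"
  by (rule mfps_eqI) (simp add: mfps_monom_def ring_hom_fun_zero, simp add: ring_hom_fun_def)

text \<open>Lifted identities hold only up to the kernel of evaluation at \<open>q\<close>.
  Evaluation at \<open>t\<close> sends this kernel to multiples of \<open>p\<close>, so identities
  at \<open>q\<close> become congruences modulo \<open>p\<close>.\<close>

lemma specialized_zero_dvd:
  assumes "mfps_map (\<lambda>P. int_poly_eval P q) W = 0"
    and "\<And>P. int_poly_eval P q = 0 \<Longrightarrow> p dvd poly P t"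
  shows "mfps_const p dvd mfps_map (\<lambda>P. poly P t) W"
  using assms by (simp add: mfps_const_dvd_iff mfps_eq_iff)

text \<open>The congruence modulo the cyclotomic value at \<open>q\<close> is lifted and then
  evaluated at \<open>t\<close>; its error term acquires the factor \<open>\<Phi>(t)\<close>, which
  \<open>p\<close> divides.\<close>

lemma D_set_specialized_cong:
  fixes F :: "('v::finite, int poly) mfps"
  assumes f: "f \<in> D_set q g" and F: "f = mfps_map (\<lambda>P. int_poly_eval P q) F"
    and b: "b \<ge> 1" and \<Phi>: "map_poly of_int \<Phi> = cyclotomic b" "p dvd poly \<Phi> t"
    and spec: "\<And>P. int_poly_eval P q = 0 \<Longrightarrow> p dvd poly P t"
  shows "\<exists>A E. deg_le E A \<and>
    mfps_const p dvd mfps_map (\<lambda>P. poly P t) F - A * mfps_subst_pow b g"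
proof -
  let ?ev = "\<lambda>P. int_poly_eval P q" and ?sp = "\<lambda>P :: int poly. poly P t"
  note ev = ring_hom_fun_int_poly_eval[of q]
  note sp = ring_hom_fun_poly[of t]
  obtain A :: "('v, complex) mpoly" where A: "\<And>m. mfps_nth (mfps_of_mpoly A) m \<in> int_adjoin q"
    and "mfps_cong (int_adjoin q) (poly (cyclotomic b) q)
      f (mfps_of_mpoly A * mfps_subst_pow b (mfps_map of_int g))"
    using f b unfolding D_set_def mfps_nth_mpoly by blast
  then obtain h where h: "\<And>m. mfps_nth h m \<in> int_adjoin q"
    and eq: "f - mfps_of_mpoly A * mfps_subst_pow b (mfps_map of_int g) =
      mfps_const (poly (cyclotomic b) q) * h"
    unfolding mfps_cong_def by blast
  obtain A' where A': "mfps_of_mpoly A = mfps_map ?ev A'"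
    and A'0: "\<And>m. mfps_nth (mfps_of_mpoly A) m = 0 \<Longrightarrow> mfps_nth A' m = 0"
    using mfps_lift_int_adjoin[OF A] by blast
  obtain H where H: "h = mfps_map ?ev H"
    using mfps_lift_int_adjoin[OF h] by blast
  obtain E where "deg_le E (mfps_of_mpoly A)"
    using deg_le_mpoly_ex by blast
  then have "deg_le E (mfps_map ?sp A')"
    using A'0 by (simp add: deg_le_iff)
  \<comment> \<open>Integer coefficients lift to constant polynomials, on which evaluation at
    \<open>q\<close> and at \<open>t\<close> both return \<open>g\<close>.\<close>
  define G where "G = mfps_map (\<lambda>c. [:c:]) g"
  have G: "mfps_map ?ev G = mfps_map of_int g" "mfps_map ?sp G = g"
    by (simp_all add: G_def mfps_eq_iff map_poly_pCons)
  define W where "W = F - A' * mfps_subst_pow b G - mfps_const \<Phi> * H"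
  have "mfps_map ?ev W = mfps_map ?ev F - mfps_map ?ev A' * mfps_subst_pow b (mfps_map ?ev G) -
      mfps_const (?ev \<Phi>) * mfps_map ?ev H"
    by (simp add: W_def mfps_map_diff[OF ev] mfps_map_mult[OF ev] mfps_map_subst_pow[OF ev]
        mfps_map_const[OF ev])
  also have "\<dots> = 0"
    using eq by (simp add: F[symmetric] A'[symmetric] H[symmetric] G \<Phi>(1))
  finally have "mfps_const p dvd mfps_map ?sp W"
    using spec by (rule specialized_zero_dvd)
  moreover have "mfps_map ?sp W = mfps_map ?sp F - mfps_map ?sp A' * mfps_subst_pow b g -
      mfps_const (?sp \<Phi>) * mfps_map ?sp H"
    by (simp add: W_def mfps_map_diff[OF sp] mfps_map_mult[OF sp] mfps_map_subst_pow[OF sp]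
        mfps_map_const[OF sp] G)
  moreover have "mfps_const p dvd mfps_const (?sp \<Phi>) * mfps_map ?sp H"
    using \<Phi>(2) by (simp add: mfps_const_dvd_iff mfps_nth_const_mult)
  ultimately have "mfps_const p dvd mfps_map ?sp F - mfps_map ?sp A' * mfps_subst_pow b g"
    by (metis dvd_add diff_add_cancel)
  with \<open>deg_le E (mfps_map ?sp A')\<close> show ?thesis
    by blast
qed

text \<open>One specialization handles all \<open>f i\<close> at once, with a common
  \<open>b\<close>, and \<open>section_relation\<close> passes to the \<open>g i\<close>. The bound
  \<open>D'\<close> may depend on the prime; it is removed later by
  \<open>L_set_reduce_degree\<close>.\<close>

lemma D_set_relation_mod_prime:
  fixes f :: "'i \<Rightarrow> ('v::finite, complex) mfps"
  assumes q: "q \<noteq> 0" and K: "finite K" and f: "\<And>i. i \<in> K \<Longrightarrow> f i \<in> D_set q (g i)"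
    and S: "finite S" and c: "\<And>m x. m \<in> S \<Longrightarrow> mfps_nth (c m) x \<in> int_adjoin q"
    and deg: "\<And>m. m \<in> S \<Longrightarrow> deg_le D (c m)"
    and rel: "(\<Sum>m\<in>S. c m * family_pow K f m) = 0" and nz: "\<exists>m\<in>S. c m \<noteq> 0"
  shows "\<exists>p c' D'. prime p \<and> p > N \<and>
    mfps_const (int p) dvd (\<Sum>m\<in>S. c' m * family_pow K g m) \<and>
    (\<exists>m\<in>S. \<not> mfps_const (int p) dvd c' m) \<and> (\<forall>m\<in>S. deg_le D' (c' m))"
proof -
  let ?ev = "\<lambda>P. int_poly_eval P q"
  obtain m0 s0 where m0: "m0 \<in> S" "mfps_nth (c m0) s0 \<noteq> 0"
    using nz by (auto simp: mfps_eq_iff)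
  have f_ring: "\<And>i m. i \<in> K \<Longrightarrow> mfps_nth (f i) m \<in> int_adjoin q"
    and f_nz: "\<And>i. i \<in> K \<Longrightarrow> f i \<noteq> 0"
    using f by (auto simp: D_set_def)
  have "\<forall>i\<in>K. \<exists>x. mfps_nth (f i) x \<noteq> 0"
    using f_nz by (auto simp: mfps_eq_iff)
  from bchoice[OF this] obtain s where s: "\<And>i. i \<in> K \<Longrightarrow> mfps_nth (f i) (s i) \<noteq> 0"
    by blast
  have "\<forall>i\<in>K. \<exists>F. f i = mfps_map ?ev F"
    using mfps_lift_int_adjoin[OF f_ring] by blast
  from bchoice[OF this] obtain F where F: "\<And>i. i \<in> K \<Longrightarrow> f i = mfps_map ?ev (F i)"
    by blast
  have "\<forall>m\<in>S. \<exists>C. c m = mfps_map ?ev C \<and> (\<forall>x. mfps_nth (c m) x = 0 \<longrightarrow> mfps_nth C x = 0)"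
    using mfps_lift_int_adjoin[OF c] by blast
  from bchoice[OF this] obtain C where C: "\<And>m. m \<in> S \<Longrightarrow> c m = mfps_map ?ev (C m)"
    and C0: "\<And>m x. m \<in> S \<Longrightarrow> mfps_nth (c m) x = 0 \<Longrightarrow> mfps_nth (C m) x = 0"
    by blast
  define \<alpha> where "\<alpha> = (\<Prod>i\<in>K. mfps_nth (F i) (s i))"
  have "?ev \<alpha> = (\<Prod>i\<in>K. mfps_nth (f i) (s i))"
    using F by (simp add: \<alpha>_def ring_hom_fun_prod[OF ring_hom_fun_int_poly_eval])
  then have "?ev \<alpha> \<noteq> 0"
    using K s by simp
  moreover have "?ev (mfps_nth (C m0) s0) \<noteq> 0"
    using m0 C[OF m0(1)] by simp
  moreover have "?ev [:0, 1:] \<noteq> 0"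
    using q by (simp add: map_poly_pCons)
  \<comment> \<open>The three factors are to survive modulo \<open>p\<close>: the first makes
    \<open>t\<close> invertible, so that it has a finite order; the second keeps the relation
    nontrivial; the third keeps every \<open>f i\<close>, and hence every \<open>A i\<close>,
    nonzero.\<close>
  ultimately have "?ev ([:0, 1:] * (mfps_nth (C m0) s0 * \<alpha>)) \<noteq> 0"
    unfolding int_poly_eval_mult by simp
  from exists_specialization[OF q this, of N]
  obtain p t where p: "prime p" "p > N"
    and spec: "\<And>P. ?ev P = 0 \<Longrightarrow> int p dvd poly P t"
    and "\<not> int p dvd poly ([:0, 1:] * (mfps_nth (C m0) s0 * \<alpha>)) t"
    by blast
  then have np: "\<not> int p dvd t" "\<not> int p dvd poly (mfps_nth (C m0) s0) t" "\<not> int p dvd poly \<alpha> t"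
    by (auto intro: dvd_mult dvd_mult2)
  have prime: "prime_or_zero (int p)"
    using p(1) by (auto simp: prime_or_zero_def prime_dvd_mult_iff)
  let ?sp = "mfps_map (\<lambda>P :: int poly. poly P t)"
  obtain b \<Phi> where b: "b \<ge> 1" and \<Phi>: "map_poly of_int \<Phi> = cyclotomic b" "int p dvd poly \<Phi> t"
    using exists_cyclotomic_dvd[OF p(1) np(1)] by blast
  have "\<forall>i\<in>K. \<exists>A. (\<exists>E. deg_le E A) \<and>
      mfps_const (int p) dvd ?sp (F i) - A * mfps_subst_pow b (g i)"
    using D_set_specialized_cong[OF f F b \<Phi> spec] by blast
  from bchoice[OF this] obtain A where A_deg: "\<And>i. i \<in> K \<Longrightarrow> \<exists>E. deg_le E (A i)"
    and A: "\<And>i. i \<in> K \<Longrightarrow> mfps_const (int p) dvd ?sp (F i) - A i * mfps_subst_pow b (g i)"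
    by blast
  from A_deg have "\<forall>i\<in>K. \<exists>E. deg_le E (A i)"
    by blast
  from bchoice[OF this] obtain E where E: "\<And>i. i \<in> K \<Longrightarrow> deg_le (E i) (A i)"
    by blast
  have A_nz: "\<not> mfps_const (int p) dvd A i" if i: "i \<in> K" for i
  proof
    assume "mfps_const (int p) dvd A i"
    with A[OF i] have "mfps_const (int p) dvd ?sp (F i)"
      by (metis diff_add_cancel dvd_add dvd_mult2)
    then have "int p dvd poly (mfps_nth (F i) (s i)) t"
      by (simp add: mfps_const_dvd_iff)
    moreover have "poly (mfps_nth (F i) (s i)) t dvd poly \<alpha> t"
      unfolding \<alpha>_def poly_prod using K i by (rule dvd_prodI)
    ultimately show False
      using np(3) dvd_trans by blast
  qed
  have "family_pow K f m = family_pow K (\<lambda>i. mfps_map ?ev (F i)) m" for m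
    using F by (simp add: family_pow_def)
  then have "mfps_map ?ev (\<Sum>m\<in>S. C m * family_pow K F m) = (\<Sum>m\<in>S. c m * family_pow K f m)"
    using C by (simp add: mfps_map_relation[OF ring_hom_fun_int_poly_eval])
  then have "mfps_const (int p) dvd ?sp (\<Sum>m\<in>S. C m * family_pow K F m)"
    using rel spec by (intro specialized_zero_dvd[of q]) auto
  then have rel': "mfps_const (int p) dvd (\<Sum>m\<in>S. ?sp (C m) * family_pow K (\<lambda>i. ?sp (F i)) m)"
    by (simp add: mfps_map_relation[OF ring_hom_fun_poly])
  have nz': "\<exists>m\<in>S. \<not> mfps_const (int p) dvd ?sp (C m)"
    using m0(1) np(2) by (auto simp: mfps_const_dvd_iff)
  have deg': "deg_le D (?sp (C m))" if "m \<in> S" for m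
    using deg[OF that] C0[OF that] by (simp add: deg_le_iff)
  define e where "e m = (\<Sum>i\<in>K. Poly_Mapping.lookup m i) * sum E K" for m :: "'i \<Rightarrow>\<^sub>0 nat"
  have "deg_le (e m) (family_pow K A m)" for m
    unfolding e_def using K by (intro deg_le_family_pow deg_le_mono[OF E]) (auto intro: member_le_sum)
  then have degA: "deg_le (sum e S) (family_pow K A m)" if "m \<in> S" for m
    by (rule deg_le_mono) (use that S in \<open>auto intro: member_le_sum\<close>)
  have "b > 0"
    using b by simp
  from section_relation[OF prime this K A A_nz rel' nz' deg' degA] p show ?thesis
    by blast
qed

section \<open>Relations as linear dependences\<close>

text \<open>This reassembles scalars indexed by pairs of exponents into the polynomial coefficient
  of \<open>F m\<close>, inverting the expansion of
  \<open>mfps_nth_linear_combination\<close>.\<close>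

definition box_series :: "nat \<Rightarrow> (('v \<Rightarrow>\<^sub>0 nat) \<times> 'm \<Rightarrow> 'a) \<Rightarrow> 'm \<Rightarrow> ('v, 'a::zero) mfps" where
  "box_series D l m = Abs_mfps (\<lambda>s. if s \<in> monomial_box D then l (s, m) else 0)"

lemma mfps_nth_box_series [simp]:
  "mfps_nth (box_series D l m) s = (if s \<in> monomial_box D then l (s, m) else 0)"
  by (simp add: box_series_def)

lemma deg_le_box_series: "deg_le D (box_series D l m)"
  by (simp add: deg_le_iff)

lemma box_series_relation_eq_0_iff:
  fixes F :: "'m \<Rightarrow> ('v::finite, 'a::comm_ring_1) mfps"
  shows "(\<Sum>m\<in>S. box_series D l m * F m) = 0 \<longleftrightarrow>
    (\<forall>x. (\<Sum>j\<in>monomial_box D \<times> S. l j * mfps_nth (mfps_monom (fst j) * F (snd j)) x) = 0)"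
proof -
  have "mfps_nth (\<Sum>m\<in>S. box_series D l m * F m) x =
      (\<Sum>j\<in>monomial_box D \<times> S. l j * mfps_nth (mfps_monom (fst j) * F (snd j)) x)" for x
    unfolding mfps_nth_linear_combination[OF deg_le_box_series]
    by (intro sum.cong) (auto simp: case_prod_unfold)
  then show ?thesis
    by (simp add: mfps_eq_iff)
qed

text \<open>The series \<open>mfps_monom s * family_pow K f m\<close> have coefficients in
  \<open>int_adjoin q\<close>, so a dependence over the complex numbers descends to that subring
  without raising the degree.\<close>

lemma int_adjoin_relation:
  fixes f :: "'i \<Rightarrow> ('v::finite, complex) mfps"
  assumes f: "\<And>i x. i \<in> K \<Longrightarrow> mfps_nth (f i) x \<in> int_adjoin q"
    and S: "finite S" and deg: "\<And>m. m \<in> S \<Longrightarrow> deg_le D (c m)"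
    and rel: "(\<Sum>m\<in>S. c m * family_pow K f m) = 0" and nz: "\<exists>m\<in>S. c m \<noteq> 0"
  shows "\<exists>c'. (\<forall>m\<in>S. \<forall>x. mfps_nth (c' m) x \<in> int_adjoin q) \<and> (\<forall>m\<in>S. deg_le D (c' m)) \<and>
    (\<Sum>m\<in>S. c' m * family_pow K f m) = 0 \<and> (\<exists>m\<in>S. c' m \<noteq> 0)"
proof -
  let ?ev = "\<lambda>P. int_poly_eval P q"
  note ev = ring_hom_fun_int_poly_eval[of q]
  have "\<forall>i\<in>K. \<exists>F. f i = mfps_map ?ev F"
    using mfps_lift_int_adjoin[OF f] by blast
  from bchoice[OF this] obtain F where F: "\<And>i. i \<in> K \<Longrightarrow> f i = mfps_map ?ev (F i)"
    by blast
  let ?J = "(monomial_box D :: ('v \<Rightarrow>\<^sub>0 nat) set) \<times> S"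
  define v where "v j x = mfps_nth (mfps_monom (fst j) * family_pow K f (snd j)) x"
    for j :: "('v \<Rightarrow>\<^sub>0 nat) \<times> ('i \<Rightarrow>\<^sub>0 nat)" and x
  have "v j x = ?ev (mfps_nth (mfps_monom (fst j) * family_pow K F (snd j)) x)" for j x
  proof -
    have "family_pow K f (snd j) = mfps_map ?ev (family_pow K F (snd j))"
      using F by (simp add: family_pow_hom[OF ring_hom_fun_mfps_map[OF ev]], simp add: family_pow_def)
    then have "mfps_monom (fst j) * family_pow K f (snd j) =
        mfps_map ?ev (mfps_monom (fst j) * family_pow K F (snd j))"
      by (simp add: mfps_map_monom[OF ev] mfps_map_mult[OF ev])
    then show ?thesis
      by (simp add: v_def)
  qed
  then have v: "v j x \<in> int_adjoin q" for j x
    by (simp add: int_adjoin_eq_range)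
  define l where "l j = mfps_nth (c (snd j)) (fst j)" for j
  have c: "c m = box_series D l m" if "m \<in> S" for m
    using deg[OF that] by (intro mfps_eqI) (auto simp: l_def deg_le_iff)
  have "(\<Sum>m\<in>S. box_series D l m * family_pow K f m) = 0"
    using rel c by simp
  then have l: "(\<Sum>j\<in>?J. l j * v j x) = 0" for x
    unfolding box_series_relation_eq_0_iff v_def by blast
  obtain m s where ms: "m \<in> S" "mfps_nth (c m) s \<noteq> 0"
    using nz by (auto simp: mfps_eq_iff)
  then have "(s, m) \<in> ?J" "l (s, m) \<noteq> 0"
    using deg[OF ms(1)] by (auto simp: l_def deg_le_iff)
  \<comment> \<open>The choice \<open>d = 0\<close> expresses an honest dependence: 0 divides only
    0, and it is prime in a domain.\<close>
  then have dep: "\<exists>d l. prime_or_zero d \<and> \<not> d dvd r \<and> (\<exists>j\<in>?J. \<not> d dvd l j) \<and>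
      (\<forall>x. d dvd (\<Sum>j\<in>?J. l j * v j x))" if "r \<in> int_adjoin q" "r \<noteq> 0" for r
    using that(2) l by (intro exI[of _ 0] exI[of _ l]) (auto simp: prime_or_zero_def)
  have fin: "finite ?J"
    by (rule finite_cartesian_product[OF finite_monomial_box S])
  have "\<exists>l. (\<forall>j\<in>?J. l j \<in> int_adjoin q) \<and> (\<exists>j\<in>?J. l j \<noteq> 0) \<and> (\<forall>x. (\<Sum>j\<in>?J. l j * v j x) = 0)"
    by (rule linear_dependence_descent[OF fin]) (rule int_adjoin_closed v dep; assumption)+
  then obtain l' where l': "\<forall>j\<in>?J. l' j \<in> int_adjoin q" "\<exists>j\<in>?J. l' j \<noteq> 0"
    and zero: "\<forall>x. (\<Sum>j\<in>?J. l' j * v j x) = 0"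
    by iprover
  have "(\<Sum>m\<in>S. box_series D l' m * family_pow K f m) = 0"
    unfolding box_series_relation_eq_0_iff using zero by (simp add: v_def)
  moreover have "\<forall>m\<in>S. \<forall>x. mfps_nth (box_series D l' m) x \<in> int_adjoin q"
    using l'(1) int_adjoin_closed(3)[OF int_adjoin_closed(1) int_adjoin_closed(1)] by auto
  moreover have "\<exists>m\<in>S. box_series D l' m \<noteq> 0"
    using l'(2) by (auto simp: mfps_eq_iff)
  ultimately show ?thesis
    by (intro exI[of _ "box_series D l'"] conjI; (assumption | simp add: deg_le_box_series))
qed

text \<open>Since \<open>S\<close> and \<open>D\<close> are the same for all primes, one fixed
  finite family is dependent modulo arbitrarily large primes. For given \<open>r \<noteq> 0\<close>,
  a prime above its absolute value does not divide it, so \<open>linear_dependence_descent\<close>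
  applies.\<close>

lemma int_relation_of_mod_primes:
  fixes g :: "'i \<Rightarrow> ('v::finite, int) mfps"
  assumes S: "finite S"
    and rel: "\<And>N. \<exists>p c. prime p \<and> p > N \<and>
      mfps_const (int p) dvd (\<Sum>m\<in>S. c m * family_pow K g m) \<and>
      (\<exists>m\<in>S. \<not> mfps_const (int p) dvd c m) \<and> (\<forall>m\<in>S. deg_le D (c m))"
  shows "\<exists>c. (\<forall>m\<in>S. deg_le D (c m)) \<and> (\<Sum>m\<in>S. c m * family_pow K g m) = 0 \<and> (\<exists>m\<in>S. c m \<noteq> 0)"
proof -
  let ?J = "(monomial_box D :: ('v \<Rightarrow>\<^sub>0 nat) set) \<times> S"
  define v where "v j x = mfps_nth (mfps_monom (fst j) * family_pow K g (snd j)) x"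
    for j :: "('v \<Rightarrow>\<^sub>0 nat) \<times> ('i \<Rightarrow>\<^sub>0 nat)" and x
  have dep: "\<exists>d l. prime_or_zero d \<and> \<not> d dvd r \<and> (\<exists>j\<in>?J. \<not> d dvd l j) \<and>
      (\<forall>x. d dvd (\<Sum>j\<in>?J. l j * v j x))" if r: "r \<noteq> 0" for r :: int
  proof -
    obtain p c where p: "prime p" "p > nat \<bar>r\<bar>"
      and dvd: "mfps_const (int p) dvd (\<Sum>m\<in>S. c m * family_pow K g m)"
      and nz: "\<exists>m\<in>S. \<not> mfps_const (int p) dvd c m" and deg: "\<And>m. m \<in> S \<Longrightarrow> deg_le D (c m)"
      using rel by blast
    define l where "l j = mfps_nth (c (snd j)) (fst j)" for j
    have "(\<Sum>j\<in>?J. l j * v j x) = mfps_nth (\<Sum>m\<in>S. c m * family_pow K g m) x" for x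
      using mfps_nth_linear_combination[of S D c "family_pow K g" x, OF deg]
      by (simp add: l_def v_def case_prod_unfold)
    then have "int p dvd (\<Sum>j\<in>?J. l j * v j x)" for x
      using dvd by (simp add: mfps_const_dvd_iff)
    moreover obtain m s where ms: "m \<in> S" "\<not> int p dvd mfps_nth (c m) s"
      using nz by (auto simp: mfps_const_dvd_iff)
    then have "s \<in> monomial_box D"
      using deg[OF ms(1)] by (auto simp: deg_le_iff)
    with ms have "\<exists>j\<in>?J. \<not> int p dvd l j"
      by (auto simp: l_def)
    moreover have "prime_or_zero (int p)"
      using p(1) by (auto simp: prime_or_zero_def prime_dvd_mult_iff)
    moreover have "\<not> int p dvd r"
      using p(2) r zdvd_imp_le[of "int p" "\<bar>r\<bar>"] by auto
    ultimately show ?thesis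
      by blast
  qed
  have fin: "finite ?J"
    by (rule finite_cartesian_product[OF finite_monomial_box S])
  have "\<exists>l. (\<forall>j\<in>?J. l j \<in> UNIV) \<and> (\<exists>j\<in>?J. l j \<noteq> 0) \<and> (\<forall>x. (\<Sum>j\<in>?J. l j * v j x) = 0)"
    by (rule linear_dependence_descent[OF fin]) (rule UNIV_I dep; assumption)+
  then obtain l where l: "\<exists>j\<in>?J. l j \<noteq> 0" and zero: "\<And>x. (\<Sum>j\<in>?J. l j * v j x) = 0"
    by blast
  have "(\<Sum>m\<in>S. box_series D l m * family_pow K g m) = 0"
    unfolding box_series_relation_eq_0_iff using zero by (simp add: v_def)
  moreover have "\<exists>m\<in>S. box_series D l m \<noteq> 0"
    using l by (auto simp: mfps_eq_iff)
  ultimately show ?thesis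
    by (intro exI[of _ "box_series D l"]) (simp add: deg_le_box_series)
qed

theorem theorem1p3:
  fixes q :: complex
    and n :: nat
    and g :: "nat \<Rightarrow> ('d::finite, int) mfps"
    and f :: "nat \<Rightarrow> ('d, complex) mfps"
  assumes "q \<noteq> 0"
    and "\<And>i. i \<in> {1..n} \<Longrightarrow> g i \<in> L_set"
    and "mfps_alg_independent {1..n} (\<lambda>i. mfps_map of_int (g i))"
    and "\<And>i. i \<in> {1..n} \<Longrightarrow> f i \<in> D_set q (g i)"
  shows "mfps_alg_independent {1..n} f"
proof (rule mfps_alg_independentI, simp, rule ccontr)
  let ?K = "{1..n}"
  fix S D and c :: "(nat \<Rightarrow>\<^sub>0 nat) \<Rightarrow> ('d, complex) mfps"
  assume S: "finite S" and keys: "\<And>m. m \<in> S \<Longrightarrow> Poly_Mapping.keys m \<subseteq> ?K"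
    and deg: "\<And>m. m \<in> S \<Longrightarrow> deg_le D (c m)"
    and rel: "(\<Sum>m\<in>S. c m * family_pow ?K f m) = 0" and neg: "\<not> (\<forall>m\<in>S. c m = 0)"
  have f: "mfps_nth (f i) x \<in> int_adjoin q" if "i \<in> ?K" for i x
    using assms(4)[OF that] by (simp add: D_set_def)
  from neg have "\<exists>m\<in>S. c m \<noteq> 0"
    by blast
  from int_adjoin_relation[OF f S deg rel this]
  obtain c' where c': "\<And>m x. m \<in> S \<Longrightarrow> mfps_nth (c' m) x \<in> int_adjoin q"
    "\<And>m. m \<in> S \<Longrightarrow> deg_le D (c' m)"
    "(\<Sum>m\<in>S. c' m * family_pow ?K f m) = 0" "\<exists>m\<in>S. c' m \<noteq> 0"
    by blast
  \<comment> \<open>A crude common bound for the degrees in the \<open>g i\<close>; it depends on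
    \<open>S\<close> alone and not on the primes.\<close>
  define e where "e = (\<Sum>m\<in>S. \<Sum>i\<in>?K. Poly_Mapping.lookup m i)"
  have e: "(\<Sum>i\<in>?K. Poly_Mapping.lookup m i) \<le> e" if "m \<in> S" for m
    unfolding e_def using that S by (intro member_le_sum) auto
  \<comment> \<open>The bound \<open>D'\<close> varies with the prime; the Lucas congruences modulo
    that same prime lower it to \<open>e\<close>.\<close>
  have "\<exists>p c. prime p \<and> p > N \<and> mfps_const (int p) dvd (\<Sum>m\<in>S. c m * family_pow ?K g m) \<and>
      (\<exists>m\<in>S. \<not> mfps_const (int p) dvd c m) \<and> (\<forall>m\<in>S. deg_le e (c m))" for N
  proof -
    obtain p a D' where p: "prime p" "p > N"
      and a: "mfps_const (int p) dvd (\<Sum>m\<in>S. a m * family_pow ?K g m)"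
        "\<exists>m\<in>S. \<not> mfps_const (int p) dvd a m" "\<And>m. m \<in> S \<Longrightarrow> deg_le D' (a m)"
      using D_set_relation_mod_prime[OF assms(1) finite_atLeastAtMost assms(4) S c', of N] by blast
    from L_set_reduce_degree[OF p(1) finite_atLeastAtMost assms(2) e a] p show ?thesis
      by blast
  qed
  from int_relation_of_mod_primes[OF S this]
  obtain h where h: "\<And>m. m \<in> S \<Longrightarrow> deg_le e (h m)"
    "(\<Sum>m\<in>S. h m * family_pow ?K g m) = 0" "\<exists>m\<in>S. h m \<noteq> 0"
    by blast
  obtain m where m: "m \<in> S" "h m \<noteq> 0"
    using h(3) by blast
  \<comment> \<open>Viewed over the complex numbers, the integral relation contradicts the
    independence of the \<open>g i\<close>.\<close>
  have "(\<Sum>m\<in>S. mfps_map of_int (h m) * family_pow ?K (\<lambda>i. mfps_map of_int (g i)) m) =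
      (0 :: ('d, complex) mfps)"
    using h(2) by (simp flip: mfps_map_relation[OF ring_hom_fun_of_int]) (simp add: mfps_eq_iff)
  moreover have "deg_le e (mfps_map of_int (h m) :: ('d, complex) mfps)" if "m \<in> S" for m
    using h(1)[OF that] by (simp add: deg_le_def)
  ultimately have "mfps_map of_int (h m) = (0 :: ('d, complex) mfps)"
    using mfps_alg_independentD[OF assms(3) finite_atLeastAtMost S keys _ _ m(1),
        where c = "\<lambda>m. mfps_map of_int (h m)"] by blast
  with m(2) show False
    by (simp add: mfps_eq_iff)
qed

end
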